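(* Let $\mathsf{A}=\{A_1,\ldots,A_\ell\} \subset \mathbf{M}_d(\mathbb{C})$ be a finite set, and suppose that the discrete linear inclusion associated to $\mathsf{A}$ is periodically asymptotically stable. Then it is also Markov asymptotically stable.
   Context: $\mathbf{M}_d(\mathbb{C})$ is the set of $d\times d$ complex matrices. $\Sigma_\ell=\{1,\dots,\ell\}^{\mathbb{N}}$ is the space of one-sided sequences $x=(x_i)_{i=1}^\infty$ with the product topology. For $x\in\Sigma_\ell$ and $n\ge1$, $\mathcal{L}_{\mathsf{A}}(x,n):=A_{x_n}A_{x_{n-1}}\cdots A_{x_1}$. The discrete linear inclusion associated to $\mathsf{A}$ is the set of all sequences $(v_n)_{n\ge0}$ in $\mathbb{C}^d$ of the form $v_n=\mathcal{L}_{\mathsf{A}}(x,n)v_0$ for some $x\in\Sigma_\ell$. It is periodically asymptotically stable if $\mathcal{L}_{\mathsf{A}}(x,n)\to0$ as $n\to\infty$ for every periodic sequence $x\in\Sigma_\ell$. It is Markov asymptotically stable if for every (shift-invariant) Markov measure $\mu$ on $\Sigma_\ell$ all of whose transition probabilities are nonzero, we have $\mathcal{L}_{\mathsf{A}}(x,n)\to0$ as $n\to\infty$ for $\mu$-a.e. $x$. (Such a measure is determined by an $\ell\times\ell$ stochastic matrix $P=(p_{ij})$ with all $p_{ij}>0$ and its stationary probability vector $\pi$, via $\mu(\{x: x_1=i_1,\dots,x_n=i_n\})=\pi_{i_1}p_{i_1i_2}\cdots p_{i_{n-1}i_n}$.) *)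

theory Defs
  imports "HOL-Probability.Probability"
begin

text \<open>
  The alphabet \<open>{1, \<dots>, \<ell>}\<close> is a finite type \<open>'l\<close> with \<open>CARD('l) = \<ell>\<close>, so that the one-sided
  shift space is the type \<open>nat \<Rightarrow> 'l\<close>. Sequences are indexed from 0: \<open>x k\<close> is the symbol
  $x_{k+1}$.
\<close>

definition shift_algebra :: "(nat \<Rightarrow> 'l::finite) measure" where
  "shift_algebra = PiM UNIV (\<lambda>_. count_space UNIV)"

text \<open>\<open>cocycle A x n\<close> is $A_{x_n} A_{x_{n-1}} \cdots A_{x_1}$.\<close>

primrec cocycle ::
    "('l \<Rightarrow> complex ^ 'd ^ 'd) \<Rightarrow> (nat \<Rightarrow> 'l) \<Rightarrow> nat \<Rightarrow> complex ^ 'd ^ 'd" where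
  "cocycle A x 0 = mat 1"
| "cocycle A x (Suc n) = A (x n) ** cocycle A x n"

definition periodic_seq :: "(nat \<Rightarrow> 'l) \<Rightarrow> bool" where
  "periodic_seq x \<longleftrightarrow> (\<exists>p>0. \<forall>k. x (k + p) = x k)"

definition stochastic_matrix :: "real ^ 'l ^ 'l \<Rightarrow> bool" where
  "stochastic_matrix P \<longleftrightarrow> (\<forall>i j. P $ i $ j \<ge> 0) \<and> (\<forall>i. (\<Sum>j\<in>UNIV. P $ i $ j) = 1)"

definition probability_vector :: "real ^ 'l \<Rightarrow> bool" where
  "probability_vector q \<longleftrightarrow> (\<forall>i. q $ i \<ge> 0) \<and> (\<Sum>i\<in>UNIV. q $ i) = 1"

text \<open>
  The cylinders below fix the \<open>n + 1\<close> symbols \<open>w 0, \<dots>, w n\<close>; the values of \<open>w\<close> beyond \<open>n\<close> are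
  irrelevant. Shift-invariance is the stationarity condition \<open>q v* P = q\<close>.
\<close>

definition markov_measure ::
    "real ^ 'l ^ 'l \<Rightarrow> real ^ 'l \<Rightarrow> (nat \<Rightarrow> 'l::finite) measure \<Rightarrow> bool" where
  "markov_measure P q \<mu> \<longleftrightarrow>
     stochastic_matrix P \<and> probability_vector q \<and> q v* P = q \<and>
     prob_space \<mu> \<and> sets \<mu> = sets shift_algebra \<and>
     (\<forall>n w. measure \<mu> {x. \<forall>k\<le>n. x k = w k} = q $ w 0 * (\<Prod>k<n. P $ w k $ w (Suc k)))"

text \<open>
  Both stability notions of the discrete linear inclusion are conditions on the cocycle of the
  indexed family \<open>A\<close>, so the family represents the inclusion.
\<close>

definition periodically_asymptotically_stable ::
    "('l::finite \<Rightarrow> complex ^ 'd ^ 'd) \<Rightarrow> bool" where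
  "periodically_asymptotically_stable A \<longleftrightarrow>
     (\<forall>x. periodic_seq x \<longrightarrow> cocycle A x \<longlonglongrightarrow> 0)"

definition markov_asymptotically_stable ::
    "('l::finite \<Rightarrow> complex ^ 'd ^ 'd) \<Rightarrow> bool" where
  "markov_asymptotically_stable A \<longleftrightarrow>
     (\<forall>P q \<mu>. markov_measure P q \<mu> \<and> (\<forall>i j. P $ i $ j > 0) \<longrightarrow>
        (AE x in \<mu>. cocycle A x \<longlonglongrightarrow> 0))"

end

theory Submission
  imports Defs "Jordan_Normal_Form.Schur_Decomposition"
begin

text \<open>
  Periodic stability forces every nonempty product \<open>M\<close> of the matrices to satisfy \<open>M\<^sup>k \<longlonglongrightarrow> 0\<close>,
  so the traces of all products are bounded by the dimension. Hence products are bounded modulo the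
  radical \<open>R\<close> of the trace form on the real algebra they span. The elements of \<open>R\<close> have vanishing
  power sums of eigenvalues, so \<open>R\<close> is a nil ideal, and \<open>R W\<close> is a proper subspace of every nonzero
  invariant \<open>W\<close>. On each quotient of the resulting flag of invariant subspaces the products are
  bounded, that is, all matrices are contractions in a suitable norm, and a high power of a fixed
  letter \<open>a\<close> contracts strictly. Weighting these norms gives an \<open>m\<close> and, for each \<open>\<epsilon> > 0\<close>,
  a norm on the whole space in which every matrix has norm at most \<open>1 + \<epsilon>\<close> while \<open>A\<^sub>a\<^sup>m\<close> has norm at
  most \<open>3 / 4\<close>. As the word \<open>a\<^sup>m\<close> follows any symbol with probability bounded below, for small \<open>\<epsilon>\<close>
  the expected norm of the cocycle decays exponentially, and so it is almost surely summable.
\<close>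

hide_const (open) Determinant.det Matrix.mat Matrix.vec Matrix.row Matrix.col VectorSpace.subspace
no_notation Matrix.vec_index (infixl \<open>$\<close> 100)
  and Matrix.scalar_prod (infix \<open>\<bullet>\<close> 70)

subsection \<open>Traces and eigenvalues of powers\<close>

definition mpow :: "complex ^ 'd ^ 'd \<Rightarrow> nat \<Rightarrow> complex ^ 'd ^ 'd" where
  "mpow M k = ((**) M ^^ k) (mat 1)"

lemma mpow_0 [simp]: "mpow M 0 = mat 1"
  and mpow_Suc [simp]: "mpow M (Suc k) = M ** mpow M k"
  by (simp_all add: mpow_def)

lemma mpow_commute: "M ** mpow M k = mpow M k ** M"
  by (induction k) (simp_all, metis matrix_mul_assoc)

lemma trace_mult_commute_mat:
  fixes X Y :: "complex Matrix.mat"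
  assumes "X \<in> carrier_mat n n" "Y \<in> carrier_mat n n"
  shows "(\<Sum>i<n. (X * Y) $$ (i, i)) = (\<Sum>i<n. (Y * X) $$ (i, i))"
proof -
  have "(\<Sum>i<n. (X * Y) $$ (i, i)) = (\<Sum>i<n. \<Sum>j<n. X $$ (i, j) * Y $$ (j, i))"
    using assms by (intro sum.cong) (auto simp: scalar_prod_def atLeast0LessThan)
  also have "\<dots> = (\<Sum>j<n. \<Sum>i<n. Y $$ (j, i) * X $$ (i, j))"
    by (subst sum.swap) (simp add: mult.commute)
  also have "\<dots> = (\<Sum>i<n. (Y * X) $$ (i, i))"
    using assms by (intro sum.cong) (auto simp: scalar_prod_def atLeast0LessThan)
  finally show ?thesis .
qed

text \<open>In row \<open>i\<close> and column \<open>j\<close> of \<open>B ^\<^sub>m k * B\<close>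
  only terms with \<open>i \<le> l \<le> j\<close> can be nonzero: none if \<open>j < i\<close>, and
  only \<open>l = i\<close> if \<open>j = i\<close>.\<close>

lemma upper_triangular_pow_diag:
  fixes B :: "complex Matrix.mat"
  assumes B: "B \<in> carrier_mat n n" and u: "upper_triangular B"
  shows "upper_triangular (B ^\<^sub>m k) \<and> (\<forall>i<n. (B ^\<^sub>m k) $$ (i, i) = (B $$ (i, i)) ^ k)"
proof (induction k)
  case 0
  show ?case using B by auto
next
  case (Suc k)
  let ?C = "B ^\<^sub>m k"
  have C: "?C \<in> carrier_mat n n" using B by simp
  have entry: "(?C * B) $$ (i, j) = (\<Sum>l<n. ?C $$ (i, l) * B $$ (l, j))" if "i < n" "j < n" for i j
    using B C that by (auto simp: scalar_prod_def atLeast0LessThan)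
  have cz: "?C $$ (i, l) = 0" if "l < i" "i < n" for i l
    using Suc C that by (auto simp: upper_triangular_def)
  have bz: "B $$ (i, l) = 0" if "l < i" "i < n" for i l
    using u B that by (auto simp: upper_triangular_def)
  have "(?C * B) $$ (i, j) = 0" if "j < i" "i < n" for i j
  proof -
    have "(\<Sum>l<n. ?C $$ (i, l) * B $$ (l, j)) = 0"
    proof (intro sum.neutral ballI)
      fix l assume "l \<in> {..<n}"
      then show "?C $$ (i, l) * B $$ (l, j) = 0"
        using cz[of l i] bz[of j l] that by (cases "l < i") auto
    qed
    then show ?thesis using entry[of i j] that by simp
  qed
  moreover have "(?C * B) $$ (i, i) = B $$ (i, i) ^ Suc k" if "i < n" for i
  proof -
    have "(\<Sum>l<n. ?C $$ (i, l) * B $$ (l, i)) = (\<Sum>l<n. if l = i then ?C $$ (i, i) * B $$ (i, i) else 0)"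
    proof (intro sum.cong refl)
      fix l assume "l \<in> {..<n}"
      then show "?C $$ (i, l) * B $$ (l, i) = (if l = i then ?C $$ (i, i) * B $$ (i, i) else 0)"
        using cz[of l i] bz[of i l] that by (cases l i rule: linorder_cases) auto
    qed
    then show ?thesis using entry[of i i] that Suc by (simp add: mult.commute)
  qed
  ultimately show ?case using B C by (auto simp: upper_triangular_def)
qed

section \<open>Passage to matrices indexed by numbers\<close>

definition vec_of :: "(nat \<Rightarrow> 'd) \<Rightarrow> complex ^ 'd \<Rightarrow> complex Matrix.vec" where
  "vec_of h v = Matrix.vec CARD('d::finite) (\<lambda>i. v $ h i)"

text \<open>The Schur decomposition is stated for matrices indexed by numbers below the dimension;
  the enumeration \<open>h\<close> of the index type carries \<open>M\<close> over.\<close>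

definition mat_of :: "(nat \<Rightarrow> 'd) \<Rightarrow> complex ^ 'd ^ 'd \<Rightarrow> complex Matrix.mat" where
  "mat_of h M = Matrix.mat CARD('d::finite) CARD('d) (\<lambda>(i, j). M $ h i $ h j)"

lemma carrier_mat_of: "mat_of h (M :: complex ^ 'd ^ 'd) \<in> carrier_mat CARD('d) CARD('d)"
  by (simp add: mat_of_def)

context
  fixes h :: "nat \<Rightarrow> 'd::finite"
  assumes h: "bij_betw h {..<CARD('d)} UNIV"
begin

lemma sum_reindex_enum: "(\<Sum>j<CARD('d). f (h j)) = (\<Sum>x\<in>UNIV. f x)"
  by (rule sum.reindex_bij_betw[OF h])

lemma mat_of_mult: "mat_of h (M ** N) = mat_of h M * mat_of h N"
  by (rule eq_matI)
    (auto simp: mat_of_def matrix_matrix_mult_def scalar_prod_def atLeast0LessThan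
      sum_reindex_enum[of "\<lambda>k. M $ h i $ k * N $ k $ h j" for i j])

lemma mat_of_one: "mat_of h (mat 1) = 1\<^sub>m CARD('d)"
proof (rule eq_matI)
  fix i j assume "i < dim_row (1\<^sub>m CARD('d) :: complex Matrix.mat)"
    "j < dim_col (1\<^sub>m CARD('d) :: complex Matrix.mat)"
  then have "i < CARD('d)" "j < CARD('d)" by auto
  moreover from this have "h i = h j \<longleftrightarrow> i = j"
    using h by (auto simp: bij_betw_def inj_on_def)
  ultimately show "mat_of h (mat 1) $$ (i, j) = 1\<^sub>m CARD('d) $$ (i, j)"
    by (simp add: mat_of_def Finite_Cartesian_Product.mat_def)
qed (auto simp: mat_of_def)

lemma mat_of_mpow: "mat_of h (mpow M k) = mat_of h M ^\<^sub>m k"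
proof (induction k)
  case 0
  show ?case by (simp add: mat_of_one) (simp add: mat_of_def)
next
  case (Suc k)
  \<comment> \<open>\<open>mpow\<close> adds the new factor on the left, \<open>pow_mat\<close> on
    the right; \<open>mpow_commute\<close> reconciles the two.\<close>
  then show ?case by (simp only: mpow_Suc mpow_commute mat_of_mult pow_mat.simps)
qed

lemma trace_mat_of: "trace M = (\<Sum>i<CARD('d). mat_of h M $$ (i, i))"
  by (simp add: trace_def mat_of_def sum_reindex_enum[of "\<lambda>k. M $ k $ k"])

lemma vec_of_mult: "vec_of h (M *v v) = mat_of h M *\<^sub>v vec_of h v"
  by (rule eq_vecI)
    (auto simp: mat_of_def vec_of_def matrix_vector_mult_def scalar_prod_def atLeast0LessThan
      sum_reindex_enum[of "\<lambda>k. M $ h i $ k * v $ k" for i])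

lemma vec_of_inject: "vec_of h u = vec_of h v \<longleftrightarrow> u = v"
proof
  assume eq: "vec_of h u = vec_of h v"
  have "u $ x = v $ x" for x
  proof -
    obtain i where "i < CARD('d)" "h i = x"
      using h by (metis UNIV_I bij_betw_iff_bijections lessThan_iff)
    then show ?thesis using arg_cong[OF eq, of "\<lambda>w. Matrix.vec_index w i"] by (auto simp: vec_of_def)
  qed
  then show "u = v" by (simp add: Finite_Cartesian_Product.vec_eq_iff)
qed simp

lemma vec_of_surj:
  assumes "w \<in> carrier_vec CARD('d)"
  obtains v where "w = vec_of h v"
proof
  have "inv_into {..<CARD('d)} h (h i) = i" if "i < CARD('d)" for i
    using h that by (auto simp: bij_betw_def intro: inv_into_f_f)
  then show "w = vec_of h (\<chi> x. Matrix.vec_index w (inv_into {..<CARD('d)} h x))"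
    using assms by (intro eq_vecI) (auto simp: vec_of_def)
qed

lemma vec_of_zero: "vec_of h 0 = 0\<^sub>v CARD('d)"
  by (rule eq_vecI) (auto simp: vec_of_def)

lemma vec_of_scale: "vec_of h (e *s v) = e \<cdot>\<^sub>v vec_of h v"
  by (rule eq_vecI) (auto simp: vec_of_def)

lemma eigenvalue_mat_of: "eigenvalue (mat_of h M) e \<longleftrightarrow> (\<exists>v. v \<noteq> 0 \<and> M *v v = e *s v)"
proof -
  have dim: "dim_row (mat_of h M) = CARD('d)" by (simp add: mat_of_def)
  show ?thesis
  proof
    assume "eigenvalue (mat_of h M) e"
    then obtain w where w: "w \<in> carrier_vec CARD('d)" "w \<noteq> 0\<^sub>v CARD('d)" "mat_of h M *\<^sub>v w = e \<cdot>\<^sub>v w"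
      by (auto simp: eigenvalue_def eigenvector_def dim)
    obtain v where "w = vec_of h v" using vec_of_surj[OF w(1)] .
    then show "\<exists>v. v \<noteq> 0 \<and> M *v v = e *s v"
      using w vec_of_inject vec_of_zero vec_of_mult vec_of_scale by metis
  next
    assume "\<exists>v. v \<noteq> 0 \<and> M *v v = e *s v"
    then obtain v where v: "v \<noteq> 0" "M *v v = e *s v" by blast
    have "vec_of h v \<noteq> 0\<^sub>v CARD('d)" using v vec_of_inject vec_of_zero by metis
    moreover have "mat_of h M *\<^sub>v vec_of h v = e \<cdot>\<^sub>v vec_of h v"
      using v vec_of_mult vec_of_scale by metis
    ultimately show "eigenvalue (mat_of h M) e"
      by (auto simp: eigenvalue_def eigenvector_def dim intro!: exI[of _ "vec_of h v"])
        (simp add: vec_of_def)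
  qed
qed

end

text \<open>The list is the diagonal of a Schur form \<open>B\<close> of \<open>M\<close>, so it
  counts eigenvalues with algebraic multiplicity. The diagonal of a power of \<open>B\<close>
  consists of the powers of these numbers, and conjugation preserves the trace.\<close>

lemma spectrum_list:
  fixes M :: "complex ^ 'd ^ 'd"
  obtains es where "length es = CARD('d)"
    "\<And>k. trace (mpow M k) = (\<Sum>e\<leftarrow>es. e ^ k)"
    "\<And>e. e \<in> set es \<longleftrightarrow> (\<exists>v. v \<noteq> 0 \<and> M *v v = e *s v)"
proof -
  let ?n = "CARD('d)"
  obtain h :: "nat \<Rightarrow> 'd" where h: "bij_betw h {..<?n} UNIV"
    using ex_bij_betw_nat_finite[of "UNIV :: 'd set"] by (auto simp: atLeast0LessThan)
  define T where "T = mat_of h M"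
  have T: "T \<in> carrier_mat ?n ?n" by (simp add: T_def carrier_mat_of)
  obtain es where es: "char_poly T = (\<Prod>a\<leftarrow>es. [:- a, 1:])" "length es = ?n"
    using char_poly_factorized[OF T] by blast
  obtain B P Q where dec: "schur_decomposition T es = (B, P, Q)" by (cases "schur_decomposition T es")
  from schur_decomposition[OF T es(1) dec]
  have sim: "similar_mat_wit T B P Q" and ut: "upper_triangular B" and dg: "diag_mat B = es" by auto
  have BPQ: "B \<in> carrier_mat ?n ?n" "P \<in> carrier_mat ?n ?n" "Q \<in> carrier_mat ?n ?n" "Q * P = 1\<^sub>m ?n"
    using sim T by (auto simp: similar_mat_wit_def Let_def)
  have "trace (mpow M k) = (\<Sum>e\<leftarrow>es. e ^ k)" for k
  proof -
    have "trace (mpow M k) = (\<Sum>i<?n. (T ^\<^sub>m k) $$ (i, i))"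
      by (simp add: trace_mat_of[OF h] mat_of_mpow[OF h] T_def)
    also have "T ^\<^sub>m k = P * B ^\<^sub>m k * Q"
      using similar_mat_wit_pow_id[OF sim] .
    also have "(\<Sum>i<?n. (P * B ^\<^sub>m k * Q) $$ (i, i)) = (\<Sum>i<?n. (Q * (P * B ^\<^sub>m k)) $$ (i, i))"
      using BPQ by (intro trace_mult_commute_mat) auto
    also have "Q * (P * B ^\<^sub>m k) = (Q * P) * B ^\<^sub>m k"
      using BPQ by (intro assoc_mult_mat[symmetric]) auto
    also have "\<dots> = B ^\<^sub>m k" using BPQ by simp
    also have "(\<Sum>i<?n. (B ^\<^sub>m k) $$ (i, i)) = (\<Sum>i<?n. (es ! i) ^ k)"
      using upper_triangular_pow_diag[OF BPQ(1) ut, of k] BPQ(1)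
      by (auto simp: dg[symmetric] diag_mat_def intro!: sum.cong)
    also have "\<dots> = (\<Sum>e\<leftarrow>es. e ^ k)"
      by (simp add: sum_list_sum_nth es(2) atLeast0LessThan)
    finally show ?thesis .
  qed
  moreover have "e \<in> set es \<longleftrightarrow> (\<exists>v. v \<noteq> 0 \<and> M *v v = e *s v)" for e
  proof -
    have "e \<in> set es \<longleftrightarrow> poly (char_poly T) e = 0"
      by (auto simp: es(1) poly_prod_list prod_list_zero_iff image_iff)
    then show ?thesis
      using eigenvalue_root_char_poly[OF T] eigenvalue_mat_of[OF h, of M e] by (simp add: T_def)
  qed
  ultimately show thesis using es(2) that by blast
qed

text \<open>Summing a polynomial without constant term over the list gives zero. If the polynomial
  vanishes at all listed values except \<open>1\<close>, the same sum is the multiplicity of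
  \<open>1\<close> times a nonzero number.\<close>

lemma one_notin_if_power_sums_zero:
  fixes es :: "complex list"
  assumes "\<And>k. k > 0 \<Longrightarrow> (\<Sum>e\<leftarrow>es. e ^ k) = 0"
  shows "1 \<notin> set es"
proof
  assume one: "1 \<in> set es"
  \<comment> \<open>The factor \<open>[:0, 1:]\<close> removes the constant term, because nothing is
    assumed about \<open>k = 0\<close>.\<close>
  define f :: "complex poly" where "f = [:0, 1:] * (\<Prod>a\<in>set es - {1}. [:- a, 1:])"
  have f0: "coeff f 0 = 0" by (simp add: f_def)
  have "(\<Sum>e\<leftarrow>es. poly f e) = (\<Sum>e\<leftarrow>es. \<Sum>k\<le>degree f. coeff f k * e ^ k)"
    by (simp add: poly_altdef)
  also have "\<dots> = (\<Sum>k\<le>degree f. coeff f k * (\<Sum>e\<leftarrow>es. e ^ k))"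
    by (induction es) (simp_all add: sum.distrib algebra_simps)
  also have "\<dots> = 0"
    using assms f0 by (intro sum.neutral) (metis mult_eq_0_iff neq0_conv)
  finally have zero: "(\<Sum>e\<leftarrow>es. poly f e) = 0" .
  have "poly f e = (if e = 1 then poly f 1 else 0)" if "e \<in> set es" for e
    using that by (auto simp: f_def poly_prod)
  then have "(\<Sum>e\<leftarrow>es. poly f e) = (\<Sum>e\<leftarrow>es. if e = 1 then poly f 1 else 0)"
    by (intro arg_cong[where f = sum_list] map_cong) auto
  also have "\<dots> = of_nat (count_list es 1) * poly f 1"
    by (induction es) (auto simp: algebra_simps)
  finally have "of_nat (count_list es 1) * poly f 1 = 0" using zero by simp
  moreover have "poly f 1 \<noteq> 0" by (auto simp: f_def poly_prod)
  ultimately show False using one by (simp add: count_list_0_iff)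
qed

subsection \<open>Seminorms on subspaces\<close>

text \<open>Scalars are real even if the vectors are complex, so that facts about real Euclidean
  spaces apply. Values of \<open>p\<close> outside \<open>V\<close> are arbitrary.\<close>

definition seminorm_on :: "'a::real_vector set \<Rightarrow> ('a \<Rightarrow> real) \<Rightarrow> bool" where
  "seminorm_on V p \<longleftrightarrow>
     (\<forall>x\<in>V. \<forall>y\<in>V. p (x + y) \<le> p x + p y) \<and> (\<forall>x\<in>V. \<forall>c. p (c *\<^sub>R x) = \<bar>c\<bar> * p x)"

lemma seminorm_on_add: "seminorm_on V p \<Longrightarrow> x \<in> V \<Longrightarrow> y \<in> V \<Longrightarrow> p (x + y) \<le> p x + p y"
  by (simp add: seminorm_on_def)

lemma seminorm_on_scale: "seminorm_on V p \<Longrightarrow> x \<in> V \<Longrightarrow> p (c *\<^sub>R x) = \<bar>c\<bar> * p x"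
  by (simp add: seminorm_on_def)

lemma seminorm_on_zero: "seminorm_on V p \<Longrightarrow> 0 \<in> V \<Longrightarrow> p 0 = 0"
  using seminorm_on_scale[of V p 0 0] by simp

lemma seminorm_on_nonneg:
  assumes "seminorm_on V p" "subspace V" "x \<in> V"
  shows "0 \<le> p x"
  using seminorm_on_add[OF assms(1,3), of "-x"] seminorm_on_scale[OF assms(1,3), of "-1"]
    seminorm_on_zero[OF assms(1)] assms(2,3) by (auto simp: subspace_neg subspace_0)

lemma seminorm_on_linear:
  assumes "seminorm_on V p" "linear f" "\<And>x. x \<in> U \<Longrightarrow> f x \<in> V"
  shows "seminorm_on U (\<lambda>x. p (f x))"
  using assms by (auto simp: seminorm_on_def linear_add linear_scale)

lemma seminorm_on_norm_linear:
  fixes f :: "'a::real_vector \<Rightarrow> 'b::real_normed_vector"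
  assumes "linear f"
  shows "seminorm_on U (\<lambda>x. norm (f x))"
  using assms by (auto simp: seminorm_on_def linear_add linear_scale norm_triangle_ineq)

lemma seminorm_on_combine:
  assumes "seminorm_on V p" "seminorm_on V q" "0 \<le> c"
  shows "seminorm_on V (\<lambda>x. p x + c * q x)"
  unfolding seminorm_on_def
proof (intro conjI ballI allI)
  fix x y assume "x \<in> V" "y \<in> V"
  then have "p (x + y) \<le> p x + p y" "c * q (x + y) \<le> c * (q x + q y)"
    using assms seminorm_on_add by (auto intro!: mult_left_mono)
  then show "p (x + y) + c * q (x + y) \<le> p x + c * q x + (p y + c * q y)"
    by (simp add: algebra_simps)
next
  fix x k assume "x \<in> V"
  then show "p (k *\<^sub>R x) + c * q (k *\<^sub>R x) = \<bar>k\<bar> * (p x + c * q x)"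
    using assms by (simp add: seminorm_on_scale algebra_simps)
qed

text \<open>Serves two suprema over all products: one of traces, one of distances of images to an
  invariant subspace.\<close>

lemma seminorm_on_SUP:
  assumes I: "I \<noteq> {}" and V: "subspace V"
    and s: "\<And>i. i \<in> I \<Longrightarrow> seminorm_on V (f i)"
    and b: "\<And>x. x \<in> V \<Longrightarrow> bdd_above ((\<lambda>i. f i x) ` I)"
  shows "seminorm_on V (\<lambda>x. SUP i\<in>I. f i x)"
proof -
  have le: "(SUP i\<in>I. f i (c *\<^sub>R x)) \<le> \<bar>c\<bar> * (SUP i\<in>I. f i x)" if "x \<in> V" for x c
  proof (rule cSUP_least[OF I])
    fix i assume i: "i \<in> I"
    then show "f i (c *\<^sub>R x) \<le> \<bar>c\<bar> * (SUP i\<in>I. f i x)"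
      using seminorm_on_scale[OF s[OF i] that, of c] cSUP_upper[OF i b[OF that]]
      by (simp add: mult_left_mono)
  qed
  show ?thesis
    unfolding seminorm_on_def
  proof (intro conjI ballI allI)
    fix x y assume xy: "x \<in> V" "y \<in> V"
    show "(SUP i\<in>I. f i (x + y)) \<le> (SUP i\<in>I. f i x) + (SUP i\<in>I. f i y)"
    proof (rule cSUP_least[OF I])
      fix i assume i: "i \<in> I"
      show "f i (x + y) \<le> (SUP i\<in>I. f i x) + (SUP i\<in>I. f i y)"
        using seminorm_on_add[OF s[OF i] xy] cSUP_upper[OF i b[OF xy(1)]] cSUP_upper[OF i b[OF xy(2)]]
        by linarith
    qed
  next
    fix x c assume x: "x \<in> V"
    show "(SUP i\<in>I. f i (c *\<^sub>R x)) = \<bar>c\<bar> * (SUP i\<in>I. f i x)"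
    proof (cases "c = 0")
      case True
      have "f i 0 = 0" if "i \<in> I" for i
        using seminorm_on_zero[OF s[OF that]] V by (simp add: subspace_0)
      then show ?thesis using True I by simp
    next
      case False
      \<comment> \<open>The reverse inequality is \<open>le\<close> for the scaled vector and the
        inverse scalar.\<close>
      have "(SUP i\<in>I. f i x) \<le> \<bar>inverse c\<bar> * (SUP i\<in>I. f i (c *\<^sub>R x))"
        using le[of "c *\<^sub>R x" "inverse c"] x V False by (simp add: subspace_scale)
      then have "\<bar>c\<bar> * (SUP i\<in>I. f i x) \<le> (SUP i\<in>I. f i (c *\<^sub>R x))"
        using False by (simp add: field_simps)
      with le[OF x] show ?thesis by (simp add: antisym)
    qed
  qed
qed

text \<open>A projection stands in for the quotient by \<open>V\<close>: the map
  \<open>v - g v\<close> has kernel \<open>V\<close>, so its norm is a norm on the quotient.\<close>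

lemma linear_projection_exists:
  fixes V :: "'a::euclidean_space set"
  assumes "subspace V"
  obtains g where "linear g" "\<And>x. g x \<in> V" "\<And>x. x \<in> V \<Longrightarrow> g x = x"
proof -
  obtain g where g: "g ` UNIV \<subseteq> V" "linear g" "\<forall>v\<in>V. g (id v) = v"
    using linear_exists_left_inverse_on[OF linear_id assms] by auto
  show thesis by (rule that[of g]) (use g in auto)
qed

text \<open>Basis vectors need not lie in \<open>V\<close>. Composing \<open>p\<close> with a
  projection onto \<open>V\<close> gives a seminorm on the whole space, to which the basis expansion
  applies.\<close>

lemma seminorm_on_bounded:
  fixes V :: "'a::euclidean_space set"
  assumes V: "subspace V" and p: "seminorm_on V p"
  obtains C where "0 < C" "\<And>x. x \<in> V \<Longrightarrow> p x \<le> C * norm x"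
proof -
  obtain g where g: "linear g" "\<And>x. g x \<in> V" "\<And>x. x \<in> V \<Longrightarrow> g x = x"
    using linear_projection_exists[OF V] by blast
  define C where "C = 1 + (\<Sum>b\<in>Basis. p (g b))"
  have pg: "seminorm_on UNIV (\<lambda>x. p (g x))"
    using seminorm_on_linear[OF p g(1)] g(2) by blast
  have nn: "0 \<le> p (g b)" for b using seminorm_on_nonneg[OF pg] by simp
  have sum_le: "p (g (\<Sum>b\<in>B. f b)) \<le> (\<Sum>b\<in>B. p (g (f b)))" if "finite B" for B and f :: "'a \<Rightarrow> 'a"
    using that
  proof (induction B)
    case empty
    then show ?case using seminorm_on_zero[OF pg] by simp
  next
    case (insert b B)
    then show ?case using seminorm_on_add[OF pg, of "f b" "sum f B"] by simp
  qed
  have "p x \<le> C * norm x" if x: "x \<in> V" for x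
  proof -
    have "p x = p (g (\<Sum>b\<in>Basis. (x \<bullet> b) *\<^sub>R b))"
      using g(3)[OF x] by (simp add: euclidean_representation)
    also have "\<dots> \<le> (\<Sum>b\<in>Basis. p (g ((x \<bullet> b) *\<^sub>R b)))" by (rule sum_le) simp
    also have "\<dots> = (\<Sum>b\<in>Basis. \<bar>x \<bullet> b\<bar> * p (g b))"
      using seminorm_on_scale[OF pg] by simp
    also have "\<dots> \<le> (\<Sum>b\<in>Basis. norm x * p (g b))"
      by (intro sum_mono mult_right_mono nn Basis_le_norm)
    also have "\<dots> \<le> C * norm x" by (simp add: C_def sum_distrib_left algebra_simps)
    finally show ?thesis .
  qed
  moreover have "0 < C" using nn by (simp add: C_def add_pos_nonneg sum_nonneg)
  ultimately show thesis using that by blast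
qed

lemma seminorm_on_continuous:
  fixes V :: "'a::euclidean_space set"
  assumes V: "subspace V" and p: "seminorm_on V p"
  shows "continuous_on V p"
proof -
  obtain C where C: "0 < C" "\<And>x. x \<in> V \<Longrightarrow> p x \<le> C * norm x"
    using seminorm_on_bounded[OF V p] by blast
  have "C-lipschitz_on V p"
  proof (rule lipschitz_onI)
    fix x y assume xy: "x \<in> V" "y \<in> V"
    have "p x \<le> p y + C * norm (x - y)" if "x \<in> V" "y \<in> V" for x y
      using seminorm_on_add[OF p, of "x - y" y] C(2)[of "x - y"] that V by (simp add: subspace_diff)
    from this[OF xy] this[OF xy(2,1)] show "dist (p x) (p y) \<le> C * dist x y"
      by (simp add: dist_norm norm_minus_commute abs_le_iff)
  qed (use C in simp)
  then show ?thesis by (rule lipschitz_on_continuous_on)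
qed

text \<open>On a complement of its kernel \<open>p\<close> is a norm, hence bounded below on the
  compact unit sphere there, while \<open>q\<close> is bounded above by the norm. The kernel
  component changes neither value.\<close>

lemma seminorm_on_dominated:
  fixes V :: "'a::euclidean_space set"
  assumes V: "subspace V" and p: "seminorm_on V p" and q: "seminorm_on V q"
    and ker: "\<And>x. x \<in> V \<Longrightarrow> p x = 0 \<Longrightarrow> q x = 0"
  obtains C where "0 < C" "\<And>x. x \<in> V \<Longrightarrow> q x \<le> C * p x"
proof -
  define K where "K = {x \<in> V. p x = 0}"
  have pn: "0 \<le> p x" if "x \<in> V" for x using seminorm_on_nonneg[OF p V that] .
  have K: "subspace K"
    unfolding K_def
  proof (rule subspaceI)
    show "0 \<in> {x \<in> V. p x = 0}" using seminorm_on_zero[OF p] V by (simp add: subspace_0)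
    show "x + y \<in> {x \<in> V. p x = 0}" if "x \<in> {x \<in> V. p x = 0}" "y \<in> {x \<in> V. p x = 0}" for x y
      using seminorm_on_add[OF p, of x y] pn[of "x + y"] that V by (simp add: subspace_add)
    show "c *\<^sub>R x \<in> {x \<in> V. p x = 0}" if "x \<in> {x \<in> V. p x = 0}" for x c
      using seminorm_on_scale[OF p] that V by (simp add: subspace_scale)
  qed
  obtain g where g: "linear g" "\<And>x. g x \<in> K" "\<And>x. x \<in> K \<Longrightarrow> g x = x"
    using linear_projection_exists[OF K] by blast
  \<comment> \<open>\<open>D\<close> is the complement of \<open>K\<close> in \<open>V\<close> given
    by the projection.\<close>
  define D where "D = {x \<in> V. g x = 0}"
  have D: "subspace D"
    unfolding D_def using V g(1)
    by (auto intro!: subspaceI simp: subspace_0 subspace_add subspace_scale linear_0 linear_add linear_scale)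
  have DV: "D \<subseteq> V" by (auto simp: D_def)
  have pos: "0 < p x" if "x \<in> D" "x \<noteq> 0" for x
  proof -
    have "p x \<noteq> 0" using that g(3)[of x] by (auto simp: D_def K_def)
    then show ?thesis using pn[of x] that DV by fastforce
  qed
  have "\<exists>c>0. \<forall>x\<in>D. c * norm x \<le> p x"
  proof (cases "D \<inter> sphere 0 1 = {}")
    case True
    have "x = 0" if "x \<in> D" for x
    proof (rule ccontr)
      assume "x \<noteq> 0"
      then have "(1 / norm x) *\<^sub>R x \<in> D \<inter> sphere 0 1" using that D by (simp add: subspace_scale)
      then show False using True by blast
    qed
    then have "\<forall>x\<in>D. 1 * norm x \<le> p x" using pn DV by fastforce
    then show ?thesis by (intro exI[of _ 1]) simp
  next
    case False
    have "compact (D \<inter> sphere 0 1)" using closed_subspace[OF D] by (intro closed_Int_compact) auto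
    moreover have "continuous_on (D \<inter> sphere 0 1) p"
      using seminorm_on_continuous[OF V p] DV by (meson continuous_on_subset inf.coboundedI1)
    ultimately obtain z where z: "z \<in> D \<inter> sphere 0 1" "\<And>y. y \<in> D \<inter> sphere 0 1 \<Longrightarrow> p z \<le> p y"
      using continuous_attains_inf[of "D \<inter> sphere 0 1" p] False by blast
    have "p z * norm x \<le> p x" if "x \<in> D" for x
    proof (cases "x = 0")
      case True
      then show ?thesis using pn that DV by auto
    next
      case False
      then have "(1 / norm x) *\<^sub>R x \<in> D \<inter> sphere 0 1" using that D by (simp add: subspace_scale)
      from z(2)[OF this] have "p z \<le> 1 / norm x * p x"
        using that DV seminorm_on_scale[OF p, of x "1 / norm x"] by auto
      then show ?thesis using False by (simp add: field_simps)
    qed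
    moreover have "z \<in> D" "z \<noteq> 0" using z(1) by auto
    then have "0 < p z" by (rule pos)
    ultimately show ?thesis by blast
  qed
  then obtain c where c: "0 < c" "\<And>x. x \<in> D \<Longrightarrow> c * norm x \<le> p x" by blast
  obtain C where C: "0 < C" "\<And>x. x \<in> V \<Longrightarrow> q x \<le> C * norm x"
    using seminorm_on_bounded[OF V q] by blast
  have "q x \<le> (C / c) * p x" if x: "x \<in> V" for x
  proof -
    let ?u = "x - g x"
    have gx: "g x \<in> V" "p (g x) = 0" using g(2)[of x] by (auto simp: K_def)
    have u: "?u \<in> D" using g(1) g(3)[OF g(2)] gx x V by (simp add: D_def linear_diff subspace_diff)
    have "q x \<le> q ?u + q (g x)" using seminorm_on_add[OF q, of ?u "g x"] u DV gx by auto
    also have "\<dots> = q ?u" using ker gx by simp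
    also have "\<dots> \<le> C * norm ?u" using C(2) u DV by blast
    also have "\<dots> \<le> C * (p ?u / c)" using c(2)[OF u] c(1) C(1) by (intro mult_left_mono) (auto simp: field_simps)
    also have "p ?u \<le> p x + p ((-1) *\<^sub>R g x)"
      using seminorm_on_add[OF p, of x "(-1) *\<^sub>R g x"] x gx V by (simp add: subspace_neg)
    then have "C * (p ?u / c) \<le> C * (p x / c)"
      using seminorm_on_scale[OF p gx(1), of "-1"] gx(2) c(1) C(1) by (simp add: divide_right_mono)
    finally show ?thesis by simp
  qed
  moreover have "0 < C / c" using C c by simp
  ultimately show thesis using that by blast
qed

subsection \<open>The algebra generated by the products\<close>

lemma linear_matrix_mult_right: "linear (\<lambda>X. M ** (X :: complex ^ 'd ^ 'd))"
  by (rule linearI) (simp_all add: matrix_add_ldistrib matrix_scalar_ac scalar_matrix_assoc)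

lemma linear_matrix_mult_left: "linear (\<lambda>X. (X :: complex ^ 'd ^ 'd) ** M)"
  by (rule linearI)
    (simp_all add: matrix_matrix_mult_def Finite_Cartesian_Product.vec_eq_iff sum.distrib
      scaleR_sum_right algebra_simps)

lemma linear_matrix_vector_mult_left: "linear (\<lambda>X. (X :: complex ^ 'd ^ 'd) *v v)"
  by (rule linearI)
    (simp_all add: matrix_vector_mult_def Finite_Cartesian_Product.vec_eq_iff sum.distrib
      scaleR_sum_right algebra_simps)

lemma linear_trace: "linear (trace :: complex ^ 'd ^ 'd \<Rightarrow> complex)"
  by (rule linearI) (simp_all add: trace_def sum.distrib scaleR_sum_right)

lemma linear_span_mem:
  assumes "linear f" "subspace T" "\<And>x. x \<in> S \<Longrightarrow> f x \<in> T" "x \<in> span S"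
  shows "f x \<in> T"
proof -
  have "subspace {x. f x \<in> T}"
    using linear_subspace_vimage[OF assms(1,2)] by (simp add: vimage_def)
  then show ?thesis using span_induct[of x S "\<lambda>x. f x \<in> T"] assms by blast
qed

text \<open>The case \<open>n = 0\<close> contributes the identity, so this is the monoid generated
  by the family.\<close>

definition products :: "('l \<Rightarrow> complex ^ 'd ^ 'd) \<Rightarrow> (complex ^ 'd ^ 'd) set" where
  "products A = {cocycle A x n | x n. True}"

lemma cocycle_cong: "(\<And>k. k < n \<Longrightarrow> x k = y k) \<Longrightarrow> cocycle A x n = cocycle A y n"
  by (induction n) auto

text \<open>The word of \<open>x\<close> is read first, so its product stands on the right.\<close>

lemma cocycle_append:
  "cocycle A (\<lambda>k. if k < n then x k else y (k - n)) (n + m) = cocycle A y m ** cocycle A x n"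
proof (induction m)
  case 0
  show ?case by simp (rule cocycle_cong, simp)
next
  case (Suc m)
  then show ?case by (simp add: matrix_mul_assoc)
qed

text \<open>Turns convergence along periodic sequences into convergence of powers; each step splits
  off the last period with \<open>cocycle_append\<close>.\<close>

lemma cocycle_periodic: "cocycle A (\<lambda>i. x (i mod n)) (k * n) = mpow (cocycle A x n) k"
proof (induction k)
  case 0
  show ?case by simp
next
  case (Suc k)
  have "(\<lambda>i. x (i mod n)) = (\<lambda>i. if i < k * n then x (i mod n) else x ((i - k * n) mod n))"
  proof (intro ext)
    fix i
    have "(i - k * n) mod n = i mod n" if "k * n \<le> i"
      using that by (metis le_add_diff_inverse mod_mult_self3)
    then show "x (i mod n) = (if i < k * n then x (i mod n) else x ((i - k * n) mod n))" by auto
  qed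
  then have "cocycle A (\<lambda>i. x (i mod n)) (k * n + n) =
      cocycle A (\<lambda>i. x (i mod n)) n ** cocycle A (\<lambda>i. x (i mod n)) (k * n)"
    using cocycle_append[of A "k * n" "\<lambda>i. x (i mod n)" "\<lambda>i. x (i mod n)" n] by simp
  also have "cocycle A (\<lambda>i. x (i mod n)) n = cocycle A x n" by (rule cocycle_cong) simp
  finally show ?case using Suc by (simp add: add.commute)
qed

lemma one_in_products: "mat 1 \<in> products A"
  unfolding products_def by (rule CollectI, rule exI, rule exI[of _ 0]) simp

lemma generator_in_products: "A i \<in> products A"
  unfolding products_def by (rule CollectI, rule exI[of _ "\<lambda>_. i"], rule exI[of _ "Suc 0"]) simp

lemma mult_in_products: "M \<in> products A \<Longrightarrow> N \<in> products A \<Longrightarrow> M ** N \<in> products A"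
  unfolding products_def by (clarsimp, metis cocycle_append)

lemma mpow_in_products: "M \<in> products A \<Longrightarrow> mpow M k \<in> products A"
  by (induction k) (simp_all add: one_in_products mult_in_products)

lemma products_mult_vector_in:
  assumes inv: "\<And>i v. v \<in> W \<Longrightarrow> A i *v v \<in> W" and M: "M \<in> products A" and v: "v \<in> W"
  shows "M *v v \<in> W"
proof -
  have "cocycle A x n *v v \<in> W" for x n
    using v by (induction n) (auto simp: matrix_vector_mul_assoc [symmetric] intro: inv)
  then show ?thesis using M by (auto simp: products_def)
qed

definition product_algebra :: "('l \<Rightarrow> complex ^ 'd ^ 'd) \<Rightarrow> (complex ^ 'd ^ 'd) set" where
  "product_algebra A = span (products A)"

lemma subspace_product_algebra: "subspace (product_algebra A)"
  by (simp add: product_algebra_def)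

lemma products_subset_algebra: "M \<in> products A \<Longrightarrow> M \<in> product_algebra A"
  by (simp add: product_algebra_def span_base)

lemma mult_in_product_algebra:
  assumes "M \<in> product_algebra A" "N \<in> product_algebra A"
  shows "M ** N \<in> product_algebra A"
proof -
  have right: "X ** N \<in> product_algebra A" if "X \<in> products A" for X
    by (rule linear_span_mem[OF linear_matrix_mult_right[of X] subspace_product_algebra[of A]])
      (use assms(2) that in \<open>auto simp: product_algebra_def intro: span_base mult_in_products\<close>)
  show ?thesis
    by (rule linear_span_mem[OF linear_matrix_mult_left[of N] subspace_product_algebra[of A]])
      (use assms(1) right in \<open>auto simp: product_algebra_def\<close>)
qed

lemma mpow_in_product_algebra: "M \<in> product_algebra A \<Longrightarrow> mpow M k \<in> product_algebra A"
  by (induction k) (simp_all add: one_in_products products_subset_algebra mult_in_product_algebra)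

section \<open>The radical of the trace form\<close>

definition trace_radical :: "('l \<Rightarrow> complex ^ 'd ^ 'd) \<Rightarrow> (complex ^ 'd ^ 'd) set" where
  "trace_radical A = {M \<in> product_algebra A. \<forall>N\<in>product_algebra A. trace (M ** N) = 0}"

lemma subspace_trace_radical:
  fixes A :: "'l \<Rightarrow> complex ^ 'd ^ 'd"
  shows "subspace (trace_radical A)"
proof -
  have "trace_radical A =
      product_algebra A \<inter> (\<Inter>N\<in>product_algebra A. {M. trace (M ** N) = 0})"
    by (auto simp: trace_radical_def)
  moreover have "subspace {M. trace (M ** N) = 0}" for N :: "complex ^ 'd ^ 'd"
    using linear_compose[OF linear_matrix_mult_left[of N] linear_trace]
    by (auto dest: linear_subspace_kernel simp: o_def)
  ultimately show ?thesis
    by (auto intro!: subspace_inter subspace_Inter subspace_product_algebra)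
qed

lemma radical_mult_left:
  assumes "M \<in> trace_radical A" "X \<in> product_algebra A"
  shows "X ** M \<in> trace_radical A"
proof -
  have "trace (X ** M ** N) = trace (M ** (N ** X))" for N
    by (metis matrix_mul_assoc trace_mul_sym)
  then show ?thesis using assms by (auto simp: trace_radical_def mult_in_product_algebra)
qed

text \<open>Every positive power of \<open>M\<close> is \<open>M\<close> times an element of the
  algebra, so its trace vanishes and \<open>1\<close> is not an eigenvalue. This makes the identity
  minus \<open>M\<close> injective, as the next lemma requires.\<close>

lemma radical_fixes_only_zero:
  fixes A :: "'l \<Rightarrow> complex ^ 'd ^ 'd"
  assumes M: "M \<in> trace_radical A" and v: "M *v v = v"
  shows "v = 0"
proof (rule ccontr)
  assume "v \<noteq> 0"
  obtain es where es: "length es = CARD('d)" "\<And>k. trace (mpow M k) = (\<Sum>e\<leftarrow>es. e ^ k)"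
      "\<And>e. e \<in> set es \<longleftrightarrow> (\<exists>v. v \<noteq> 0 \<and> M *v v = e *s v)"
    by (rule spectrum_list[of M], rule that)
  have "(\<Sum>e\<leftarrow>es. e ^ k) = 0" if "k > 0" for k
  proof -
    obtain j where "k = Suc j" using \<open>k > 0\<close> by (cases k) auto
    then show ?thesis
      using M mpow_in_product_algebra[of M A j] es(2)[of k] by (auto simp: trace_radical_def)
  qed
  then have "1 \<notin> set es" by (rule one_notin_if_power_sums_zero)
  then show False using es(3)[of 1] \<open>v \<noteq> 0\<close> v by auto
qed

text \<open>A Nakayama-type lemma. If \<open>U\<close> is a maximal proper invariant subspace and \<open>M v\<close> lies outside
  \<open>U\<close>, then \<open>R v + U\<close> is everything, so some \<open>1 - N\<close> maps \<open>v\<close> into \<open>U\<close>. But \<open>1 - N\<close> is injective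
  and thus maps \<open>U\<close> onto itself.\<close>

lemma nil_proper_subspace:
  fixes R :: "(complex ^ 'd ^ 'd) set" and W :: "(complex ^ 'd) set"
  assumes R: "subspace R" and mult: "\<And>M N. M \<in> R \<Longrightarrow> N \<in> R \<Longrightarrow> M ** N \<in> R"
    and nofix: "\<And>M v. M \<in> R \<Longrightarrow> M *v v = v \<Longrightarrow> v = 0"
    and W: "subspace W" "W \<noteq> {0}" and inv: "\<And>M v. M \<in> R \<Longrightarrow> v \<in> W \<Longrightarrow> M *v v \<in> W"
  obtains U where "subspace U" "U \<subset> W" "\<And>M v. M \<in> R \<Longrightarrow> v \<in> W \<Longrightarrow> M *v v \<in> U"
proof -
  define good where
    "good U \<longleftrightarrow> subspace U \<and> U \<subset> W \<and> (\<forall>M\<in>R. \<forall>v\<in>U. M *v v \<in> U)" for U :: "(complex ^ 'd) set"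
  have "good {0}" using W by (auto simp: good_def subspace_0 subspace_single_0)
  moreover have "\<forall>U. good U \<longrightarrow> dim U < Suc (dim W)"
    by (auto simp: good_def less_Suc_eq_le intro: dim_subset)
  ultimately obtain U where U: "good U" and max: "\<And>X. good X \<Longrightarrow> dim X \<le> dim U"
    using ex_has_greatest_nat[of good "{0}" dim "Suc (dim W)"] by blast
  have Us: "subspace U" "U \<subset> W" "\<And>M v. M \<in> R \<Longrightarrow> v \<in> U \<Longrightarrow> M *v v \<in> U"
    using U by (auto simp: good_def)
  have "M *v v \<in> U" if M: "M \<in> R" and v: "v \<in> W" for M v
  proof (rule ccontr)
    assume nin: "M *v v \<notin> U"
    have vU: "v \<notin> U" using nin Us M by blast
    define X where "X = {x + y | x y. x \<in> (\<lambda>N. N *v v) ` R \<and> y \<in> U}"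
    have sX: "subspace X"
      unfolding X_def
      by (intro subspace_sums linear_subspace_image linear_matrix_vector_mult_left R Us)
    have XW: "X \<subseteq> W" using Us W v inv by (auto simp: X_def intro!: subspace_add)
    have UX: "U \<subseteq> X"
    proof
      fix u assume "u \<in> U"
      moreover have "0 \<in> R" using R by (rule subspace_0)
      ultimately have "u = 0 *v v + u \<and> 0 *v v \<in> (\<lambda>N. N *v v) ` R \<and> u \<in> U"
        by (auto intro: image_eqI[of _ _ 0])
      then show "u \<in> X" unfolding X_def by blast
    qed
    have MX: "M *v v \<in> X"
      unfolding X_def using M Us(1) by (intro CollectI exI[of _ "M *v v"] exI[of _ 0]) (auto simp: subspace_0)
    have Xinv: "N *v x \<in> X" if "N \<in> R" "x \<in> X" for N x
    proof -
      obtain N' u where "N' \<in> R" "u \<in> U" "x = N' *v v + u" using \<open>x \<in> X\<close> by (auto simp: X_def)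
      then have "N *v x = (N ** N') *v v + N *v u" "N ** N' \<in> R" "N *v u \<in> U"
        using that mult Us by (auto simp: matrix_vector_right_distrib matrix_vector_mul_assoc)
      then show ?thesis unfolding X_def by blast
    qed
    have "X = W"
    proof (rule ccontr)
      assume "X \<noteq> W"
      then have "good X" using sX XW Xinv by (auto simp: good_def)
      then have "dim X \<le> dim U" by (rule max)
      then have "U = X" using subspace_dim_equal[OF Us(1) sX UX] by simp
      then show False using MX nin by simp
    qed
    then obtain N u where Nu: "N \<in> R" "u \<in> U" "v = N *v v + u" using v by (auto simp: X_def)
    define f where "f x = x - N *v x" for x
    have lf: "linear f" unfolding f_def by (intro linear_compose_sub linear_ident) simp
    have inj: "inj f"
      using nofix[OF Nu(1)] by (auto simp: linear_injective_0[OF lf] f_def)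
    have sub: "f ` U \<subseteq> U" using Us Nu(1) by (auto simp: f_def intro: subspace_diff)
    have "dim (f ` U) = dim U" using dim_image_eq[OF lf] inj by (meson inj_on_subset subset_UNIV)
    then have "f ` U = U"
      using subspace_dim_equal[OF linear_subspace_image[OF lf Us(1)] Us(1) sub] by simp
    moreover have "f v = u" using Nu(3) by (simp add: f_def algebra_simps)
    ultimately obtain u' where "u' \<in> U" "f u' = f v" using Nu(2) by (metis imageE)
    then show False using inj vU by (auto dest: injD)
  qed
  then show thesis using that Us by blast
qed

text \<open>An eigenvalue of modulus above \<open>1\<close> would keep the powers away from zero
  along its eigenvector. The trace is thus a sum of \<open>CARD('d)\<close> numbers of modulus at
  most \<open>1\<close>.\<close>

lemma norm_trace_le_if_powers_vanish:
  fixes M :: "complex ^ 'd ^ 'd"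
  assumes "mpow M \<longlonglongrightarrow> 0"
  shows "norm (trace M) \<le> CARD('d)"
proof -
  obtain es where es: "length es = CARD('d)" "\<And>k. trace (mpow M k) = (\<Sum>e\<leftarrow>es. e ^ k)"
      "\<And>e. e \<in> set es \<longleftrightarrow> (\<exists>v. v \<noteq> 0 \<and> M *v v = e *s v)"
    by (rule spectrum_list[of M], rule that)
  have small: "norm e \<le> 1" if "e \<in> set es" for e
  proof (rule ccontr)
    assume "\<not> norm e \<le> 1"
    obtain v where v: "v \<noteq> 0" "M *v v = e *s v" using es(3) \<open>e \<in> set es\<close> by blast
    then obtain i where i: "v $ i \<noteq> 0" by (auto simp: Finite_Cartesian_Product.vec_eq_iff)
    have pow: "mpow M k *v v = e ^ k *s v" for k
    proof (induction k)
      case (Suc k)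
      have "mpow M (Suc k) *v v = M *v (e ^ k *s v)"
        using Suc by (simp add: matrix_vector_mul_assoc [symmetric])
      then show ?case
        using v(2) by (simp add: vector_scalar_commute vector_smult_assoc mult.commute)
    qed simp
    have "bounded_linear (\<lambda>X :: complex ^ 'd ^ 'd. (X *v v) $ i)"
      using linear_compose[OF linear_matrix_vector_mult_left[of v], of "\<lambda>w. w $ i"]
      by (auto intro!: linearI simp: linear_conv_bounded_linear o_def)
    from bounded_linear.tendsto[OF this assms] have "(\<lambda>k. e ^ k * v $ i) \<longlonglongrightarrow> 0"
      by (simp add: pow)
    then have "(\<lambda>k. norm (e ^ k * v $ i)) \<longlonglongrightarrow> 0" by (rule tendsto_norm_zero)
    moreover have "norm (v $ i) \<le> norm (e ^ k * v $ i)" for k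
      using one_le_power[of "norm e" k] \<open>\<not> norm e \<le> 1\<close>
      by (simp add: norm_mult norm_power mult_le_cancel_right1)
    ultimately have "norm (v $ i) \<le> 0" by (meson LIMSEQ_le_const)
    then show False using i by simp
  qed
  \<comment> \<open>Generalised to lists over \<open>set es\<close>, so that the bound on
    eigenvalues stays available in the induction.\<close>
  have "norm (\<Sum>e\<leftarrow>es'. e) \<le> length es'" if "set es' \<subseteq> set es" for es'
    using that
  proof (induction es')
    case (Cons e es')
    then have "norm (\<Sum>e\<leftarrow>es'. e) \<le> length es'" "norm e \<le> 1" using small by auto
    then show ?case using norm_triangle_ineq[of e "\<Sum>e\<leftarrow>es'. e"] by simp
  qed simp
  from this[of es] show ?thesis using es(1) es(2)[of 1] by simp
qed

subsection \<open>Norms adapted to a periodically stable family\<close>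

context
  fixes A :: "'l::finite \<Rightarrow> complex ^ 'd ^ 'd"
  assumes stable: "periodically_asymptotically_stable A"
begin

text \<open>Along the multiples of \<open>n\<close>, the cocycle of the periodic extension of the
  word runs through the powers.\<close>

lemma powers_vanish:
  assumes "0 < n"
  shows "mpow (cocycle A x n) \<longlonglongrightarrow> 0"
proof -
  have "periodic_seq (\<lambda>i. x (i mod n))"
    unfolding periodic_seq_def using assms by (intro exI[of _ n]) simp
  then have "cocycle A (\<lambda>i. x (i mod n)) \<longlonglongrightarrow> 0"
    using stable by (simp add: periodically_asymptotically_stable_def)
  moreover have "strict_mono (\<lambda>k. k * n)" using assms by (simp add: strict_mono_def)
  ultimately have "(cocycle A (\<lambda>i. x (i mod n)) \<circ> (\<lambda>k. k * n)) \<longlonglongrightarrow> 0"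
    by (rule LIMSEQ_subseq_LIMSEQ)
  then show ?thesis by (simp add: o_def cocycle_periodic)
qed

lemma norm_trace_product_le:
  assumes "M \<in> products A"
  shows "norm (trace M) \<le> CARD('d)"
proof -
  obtain x n where M: "M = cocycle A x n" using assms by (auto simp: products_def)
  show ?thesis
  proof (cases "n = 0")
    \<comment> \<open>The empty word gives the identity: its powers do not vanish, but its trace
      meets the bound.\<close>
    case True
    then show ?thesis by (simp add: M trace_I)
  next
    case False
    then show ?thesis using norm_trace_le_if_powers_vanish[OF powers_vanish[of n x]] M by simp
  qed
qed

text \<open>If \<open>M\<close> is a product, so is \<open>M ** N\<close>, and
  \<open>CARD('d)\<close> is a bound. Linear combinations follow by induction over the span.\<close>

lemma trace_form_bounded:
  assumes "M \<in> product_algebra A"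
  shows "bdd_above ((\<lambda>N. norm (trace (M ** N))) ` products A)"
proof -
  have "\<exists>B. \<forall>N\<in>products A. norm (trace (M ** N)) \<le> B"
    using assms unfolding product_algebra_def
  proof (induction rule: span_induct_alt)
    case base
    have "trace ((0 :: complex ^ 'd ^ 'd) ** N) = 0" for N
      using linear_0[OF linear_matrix_mult_left[of N]] linear_0[OF linear_trace] by metis
    then show ?case by auto
  next
    case (step c X Y)
    then obtain B where B: "\<And>N. N \<in> products A \<Longrightarrow> norm (trace (Y ** N)) \<le> B" by blast
    have "norm (trace ((c *\<^sub>R X + Y) ** N)) \<le> \<bar>c\<bar> * CARD('d) + B" if "N \<in> products A" for N
    proof -
      have "trace ((c *\<^sub>R X + Y) ** N) = c *\<^sub>R trace (X ** N) + trace (Y ** N)"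
        by (simp add: linear_add[OF linear_matrix_mult_left] linear_scale[OF linear_matrix_mult_left]
            linear_add[OF linear_trace] linear_scale[OF linear_trace])
      also have "norm \<dots> \<le> \<bar>c\<bar> * norm (trace (X ** N)) + norm (trace (Y ** N))"
        by (metis norm_scaleR norm_triangle_ineq)
      also have "\<dots> \<le> \<bar>c\<bar> * CARD('d) + B"
        using B[OF that] norm_trace_product_le[OF mult_in_products[OF step(1) that]]
        by (intro add_mono mult_left_mono) auto
      finally show ?thesis .
    qed
    then show ?case by blast
  qed
  then show ?thesis by (auto simp: bdd_above_def)
qed

text \<open>Boundedness of the products modulo the radical. The supremum \<open>t\<close> of the
  trace form vanishes only on the radical, so it dominates \<open>q\<close>, and it is at most
  \<open>CARD('d)\<close> on products.\<close>

lemma seminorm_bounded_on_products: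
  assumes q: "seminorm_on (product_algebra A) q"
    and zero: "\<And>M. M \<in> trace_radical A \<Longrightarrow> q M = 0"
  shows "bdd_above (q ` products A)"
proof -
  define t where "t M = (SUP N\<in>products A. norm (trace (M ** N)))" for M
  have ne: "products A \<noteq> {}" using one_in_products by blast
  have lin: "linear (\<lambda>M. trace (M ** N))" for N :: "complex ^ 'd ^ 'd"
    using linear_compose[OF linear_matrix_mult_left[of N] linear_trace] by (simp add: o_def)
  have t: "seminorm_on (product_algebra A) t"
    unfolding t_def
    by (intro seminorm_on_SUP ne subspace_product_algebra seminorm_on_norm_linear lin trace_form_bounded)
  have ker: "q M = 0" if M: "M \<in> product_algebra A" "t M = 0" for M
  proof -
    have "trace (M ** N) = 0" if "N \<in> products A" for N
      using cSUP_upper[OF that trace_form_bounded[OF M(1)]] M(2) by (simp add: t_def)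
    then have "trace (M ** N) \<in> {0}" if "N \<in> product_algebra A" for N
      using that linear_span_mem[OF linear_compose[OF linear_matrix_mult_right[of M] linear_trace],
          of "{0}" "products A" N]
      by (auto simp: product_algebra_def o_def subspace_single_0)
    then show ?thesis using M(1) by (intro zero) (auto simp: trace_radical_def)
  qed
  obtain C where C: "0 < C" "\<And>M. M \<in> product_algebra A \<Longrightarrow> q M \<le> C * t M"
    using seminorm_on_dominated[OF subspace_product_algebra t q ker] by blast
  have "q M \<le> C * CARD('d)" if M: "M \<in> products A" for M
  proof -
    have "t M \<le> CARD('d)"
      unfolding t_def by (intro cSUP_least ne norm_trace_product_le mult_in_products M)
    then show ?thesis
      using C(1) C(2)[OF products_subset_algebra[OF M]] by (meson mult_left_mono order.trans less_imp_le)
  qed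
  then show ?thesis by (auto simp: bdd_above_def)
qed

text \<open>Modulo the span \<open>U\<close> of \<open>R W\<close> the orbit of a vector under all
  products is bounded, since the radical maps \<open>W\<close> into \<open>U\<close>. Its supremum
  \<open>p\<close> cannot grow under \<open>A i\<close>, as the products \<open>M ** A i\<close> are
  among all products.\<close>

lemma contraction_seminorm_exists:
  assumes W: "subspace W" "W \<noteq> {0}" and inv: "\<And>i v. v \<in> W \<Longrightarrow> A i *v v \<in> W"
  obtains U p where "subspace U" "U \<subset> W" "\<And>i v. v \<in> U \<Longrightarrow> A i *v v \<in> U"
    "seminorm_on W p" "\<And>v. v \<in> W \<Longrightarrow> p v = 0 \<longleftrightarrow> v \<in> U"
    "\<And>i v. v \<in> W \<Longrightarrow> p (A i *v v) \<le> p v"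
proof -
  define R where "R = trace_radical A"
  have Ralg: "M \<in> product_algebra A" if "M \<in> R" for M using that by (simp add: R_def trace_radical_def)
  have algW: "M *v v \<in> W" if "M \<in> product_algebra A" "v \<in> W" for M v
    by (rule linear_span_mem[OF linear_matrix_vector_mult_left W(1)])
      (use that inv products_mult_vector_in[of W A] in \<open>auto simp: product_algebra_def\<close>)
  obtain U0 where U0: "subspace U0" "U0 \<subset> W" "\<And>M v. M \<in> R \<Longrightarrow> v \<in> W \<Longrightarrow> M *v v \<in> U0"
  proof (rule nil_proper_subspace[of R W])
    show "subspace R" by (simp add: R_def subspace_trace_radical)
    show "M ** N \<in> R" if "M \<in> R" "N \<in> R" for M N
      using that radical_mult_left Ralg by (auto simp: R_def)
    show "v = 0" if "M \<in> R" "M *v v = v" for M v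
      using that radical_fixes_only_zero by (auto simp: R_def)
    show "M *v v \<in> W" if "M \<in> R" "v \<in> W" for M v
      using that algW Ralg by blast
  qed (use W in auto)
  \<comment> \<open>\<open>U0\<close> is not known to be invariant under the letters. The span of
    \<open>R W\<close> inside it is, because \<open>R\<close> is a left ideal.\<close>
  define G where "G = {M *v v | M v. M \<in> R \<and> v \<in> W}"
  define U where "U = span G"
  have "U \<subseteq> U0" unfolding U_def using U0 by (intro span_minimal) (auto simp: G_def)
  with U0 have UW: "U \<subset> W" by blast
  have U: "subspace U" by (simp add: U_def)
  have RU: "M *v v \<in> U" if "M \<in> R" "v \<in> W" for M v
    using that by (auto simp: U_def G_def intro!: span_base)
  have Uinv: "A i *v u \<in> U" if "u \<in> U" for i u
  proof (rule linear_span_mem[OF matrix_vector_mul_linear U _ that[unfolded U_def]])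
    fix g assume "g \<in> G"
    then obtain M v where "M \<in> R" "v \<in> W" "g = M *v v" by (auto simp: G_def)
    moreover have "A i ** M \<in> R"
      using \<open>M \<in> R\<close> radical_mult_left[OF _ products_subset_algebra[OF generator_in_products]]
      by (simp add: R_def)
    ultimately show "A i *v g \<in> U" using RU by (simp add: matrix_vector_mul_assoc)
  qed
  obtain g where g: "linear g" "\<And>x. g x \<in> U" "\<And>x. x \<in> U \<Longrightarrow> g x = x"
    using linear_projection_exists[OF U] by blast
  have lin: "linear (\<lambda>v. v - g v)" by (intro linear_compose_sub linear_ident g(1))
  define p where "p v = (SUP M\<in>products A. norm (M *v v - g (M *v v)))" for v
  have ne: "products A \<noteq> {}" using one_in_products by blast
  have bdd: "bdd_above ((\<lambda>M. norm (M *v v - g (M *v v))) ` products A)" if v: "v \<in> W" for v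
  proof (rule seminorm_bounded_on_products)
    show "seminorm_on (product_algebra A) (\<lambda>M. norm (M *v v - g (M *v v)))"
      using linear_compose[OF linear_matrix_vector_mult_left lin]
      by (intro seminorm_on_norm_linear) (simp add: o_def)
    show "norm (M *v v - g (M *v v)) = 0" if "M \<in> trace_radical A" for M
      using RU[of M v] that v g(3) by (simp add: R_def)
  qed
  have "seminorm_on W p"
    unfolding p_def
    by (intro seminorm_on_SUP ne W(1) bdd seminorm_on_norm_linear
        linear_compose[OF matrix_vector_mul_linear lin, unfolded o_def])
  moreover have "p v = 0 \<longleftrightarrow> v \<in> U" if v: "v \<in> W" for v
  proof
    assume "p v = 0"
    \<comment> \<open>The identity is one of the products, so \<open>p v\<close> bounds the norm of
      \<open>v - g v\<close>.\<close>
    then have "v - g v = 0"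
      using cSUP_upper[OF one_in_products bdd[OF v]] by (simp add: p_def)
    then show "v \<in> U" using g(2)[of v] by simp
  next
    assume "v \<in> U"
    then have "norm (M *v v - g (M *v v)) = 0" if "M \<in> products A" for M
      using products_mult_vector_in[of U A] Uinv that g(3) by simp
    then show "p v = 0" using ne by (simp add: p_def)
  qed
  moreover have "p (A i *v v) \<le> p v" if v: "v \<in> W" for i v
    unfolding p_def
  proof (rule cSUP_least[OF ne])
    fix M assume "M \<in> products A"
    then have "M ** A i \<in> products A" by (intro mult_in_products generator_in_products)
    from cSUP_upper[OF this bdd[OF v]]
    show "norm (M *v (A i *v v) - g (M *v (A i *v v))) \<le> (SUP M\<in>products A. norm (M *v v - g (M *v v)))"
      by (simp add: matrix_vector_mul_assoc)
  qed
  ultimately show thesis using that[of U p] U UW Uinv by blast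
qed

text \<open>The constant word is periodic, so the powers of \<open>A a\<close> tend to zero in norm.
  The seminorm \<open>p\<close> is equivalent to the norm of \<open>v - g v\<close>, and the
  component \<open>g v\<close> stays in \<open>U\<close>, where \<open>p\<close> vanishes.\<close>

lemma letter_powers_contract:
  assumes U: "subspace U" and W: "subspace W" "U \<subseteq> W" and inv: "\<And>i v. v \<in> W \<Longrightarrow> A i *v v \<in> W"
    and invU: "\<And>i v. v \<in> U \<Longrightarrow> A i *v v \<in> U"
    and p: "seminorm_on W p" "\<And>v. v \<in> W \<Longrightarrow> p v = 0 \<longleftrightarrow> v \<in> U"
  obtains m0 where "\<And>m v. m \<ge> m0 \<Longrightarrow> v \<in> W \<Longrightarrow> p (mpow (A a) m *v v) \<le> 1 / 2 * p v"
proof -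
  obtain g where g: "linear g" "\<And>x. g x \<in> U" "\<And>x. x \<in> U \<Longrightarrow> g x = x"
    using linear_projection_exists[OF U] by blast
  have lin: "linear (\<lambda>v. v - g v)" by (intro linear_compose_sub linear_ident g(1))
  have ker: "norm (v - g v) = 0" if "v \<in> W" "p v = 0" for v
    using p(2) g(3) that by simp
  obtain C1 where C1: "0 < C1" "\<And>v. v \<in> W \<Longrightarrow> norm (v - g v) \<le> C1 * p v"
    using seminorm_on_dominated[OF W(1) p(1) seminorm_on_norm_linear[OF lin] ker] by blast
  obtain C2 where C2: "0 < C2" "\<And>v. v \<in> W \<Longrightarrow> p v \<le> C2 * norm v"
    using seminorm_on_bounded[OF W(1) p(1)] by blast
  have "bilinear ((*v) :: complex ^ 'd ^ 'd \<Rightarrow> complex ^ 'd \<Rightarrow> complex ^ 'd)"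
    by (auto simp: bilinear_def linear_matrix_vector_mult_left)
  then obtain C3 where C3: "0 < C3" "\<And>(M :: complex ^ 'd ^ 'd) v. norm (M *v v) \<le> norm M * norm v * C3"
    using bounded_bilinear.pos_bounded bilinear_conv_bounded_bilinear by metis
  have "mpow (A a) \<longlonglongrightarrow> 0" using powers_vanish[of "Suc 0" "\<lambda>_. a"] by simp
  \<comment> \<open>This threshold makes the constants collected below cancel to the factor
    \<open>1 / 2\<close>.\<close>
  moreover have "0 < 1 / (2 * C1 * C2 * C3)" using C1 C2 C3 by simp
  ultimately obtain m0 where m0: "\<And>m. m \<ge> m0 \<Longrightarrow> norm (mpow (A a) m) < 1 / (2 * C1 * C2 * C3)"
    unfolding LIMSEQ_iff by (metis diff_zero)
  have "p (mpow (A a) m *v v) \<le> 1 / 2 * p v" if m: "m \<ge> m0" and v: "v \<in> W" for m v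
  proof -
    let ?B = "mpow (A a) m"
    have B: "?B \<in> products A" by (intro mpow_in_products generator_in_products)
    have BU: "?B *v g v \<in> U" by (rule products_mult_vector_in[OF invU B g(2)])
    have vg: "v - g v \<in> W" using W v g(2) by (auto intro: subspace_diff)
    have BW: "?B *v (v - g v) \<in> W" by (rule products_mult_vector_in[OF inv B vg])
    have "?B *v v = ?B *v (v - g v) + ?B *v g v" by (simp add: matrix_vector_mult_diff_distrib)
    then have "p (?B *v v) \<le> p (?B *v (v - g v)) + p (?B *v g v)"
      using seminorm_on_add[OF p(1) BW, of "?B *v g v"] BU W by auto
    also have "p (?B *v g v) = 0" using p(2) BU W by blast
    also have "p (?B *v (v - g v)) \<le> C2 * (norm ?B * norm (v - g v) * C3)"
      using C2(2)[OF BW] C3(2)[of ?B "v - g v"] C2(1) by (meson mult_left_mono order.trans less_imp_le)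
    also have "\<dots> \<le> C2 * (1 / (2 * C1 * C2 * C3) * (C1 * p v) * C3)"
      using C1 C2(1) C3(1) m0[OF m] v
      by (intro mult_left_mono mult_right_mono mult_mono) (auto intro: less_imp_le)
    also have "\<dots> = 1 / 2 * p v" using C1(1) C2(1) C3(1) by simp
    finally show ?thesis by simp
  qed
  then show thesis using that by blast
qed

text \<open>The exponent \<open>m\<close> does not depend on \<open>\<epsilon>\<close>. The norm is assembled along a flag of invariant
  subspaces: a large weight on the seminorm of the quotient absorbs the off-diagonal part.\<close>

lemma adapted_norm_on_subspace:
  assumes "subspace W" "\<And>i v. v \<in> W \<Longrightarrow> A i *v v \<in> W"
  shows "\<exists>m0. \<forall>m\<ge>m0. \<forall>\<epsilon>>0. \<exists>N. seminorm_on W N \<and> (\<forall>v\<in>W. N v = 0 \<longrightarrow> v = 0) \<and>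
    (\<forall>i. \<forall>v\<in>W. N (A i *v v) \<le> (1 + \<epsilon>) * N v) \<and> (\<forall>v\<in>W. N (mpow (A a) m *v v) \<le> 3 / 4 * N v)"
  using assms
proof (induction "dim W" arbitrary: W rule: less_induct)
  case less
  show ?case
  proof (cases "W = {0}")
    case True
    then show ?thesis
      by (intro exI[of _ 0] allI impI exI[of _ "\<lambda>_. 0"]) (simp add: seminorm_on_def)
  next
    case False
    obtain U p where U: "subspace U" "U \<subset> W" "\<And>i v. v \<in> U \<Longrightarrow> A i *v v \<in> U"
      and p: "seminorm_on W p" "\<And>v. v \<in> W \<Longrightarrow> p v = 0 \<longleftrightarrow> v \<in> U"
        "\<And>i v. v \<in> W \<Longrightarrow> p (A i *v v) \<le> p v"
      using contraction_seminorm_exists[OF less(2) False less(3)] by metis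
    have UW: "U \<subseteq> W" using U by blast
    have "dim U < dim W"
      using U(1,2) less(2) by (intro dim_psubset) (metis span_eq_iff)
    from less(1)[OF this U(1,3)] obtain m1 where m1: "\<And>m \<epsilon>. m \<ge> m1 \<Longrightarrow> \<epsilon> > 0 \<Longrightarrow>
      \<exists>N. seminorm_on U N \<and> (\<forall>v\<in>U. N v = 0 \<longrightarrow> v = 0) \<and>
        (\<forall>i. \<forall>v\<in>U. N (A i *v v) \<le> (1 + \<epsilon>) * N v) \<and> (\<forall>v\<in>U. N (mpow (A a) m *v v) \<le> 3 / 4 * N v)"
      by blast
    obtain m2 where m2: "\<And>m v. m \<ge> m2 \<Longrightarrow> v \<in> W \<Longrightarrow> p (mpow (A a) m *v v) \<le> 1 / 2 * p v"
      using letter_powers_contract[OF U(1) less(2) UW less(3) U(3) p(1,2)] by metis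
    show ?thesis
    proof (intro exI[of _ "max m1 m2"] allI impI)
      fix m :: nat and \<epsilon> :: real
      assume m: "m \<ge> max m1 m2" and \<epsilon>: "\<epsilon> > 0"
      let ?B = "mpow (A a) m"
      obtain N where N: "seminorm_on U N" "\<And>v. v \<in> U \<Longrightarrow> N v = 0 \<Longrightarrow> v = 0"
          "\<And>i v. v \<in> U \<Longrightarrow> N (A i *v v) \<le> (1 + \<epsilon>) * N v"
          "\<And>v. v \<in> U \<Longrightarrow> N (?B *v v) \<le> 3 / 4 * N v"
        using m1[of m \<epsilon>] m \<epsilon> by auto
      have BW: "p (?B *v v) \<le> 1 / 2 * p v" if "v \<in> W" for v using m2 m that by simp
      have B: "?B \<in> products A" by (intro mpow_in_products generator_in_products)
      obtain g where g: "linear g" "\<And>x. g x \<in> U" "\<And>x. x \<in> U \<Longrightarrow> g x = x"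
        using linear_projection_exists[OF U(1)] by blast
      have pn: "0 \<le> p v" if "v \<in> W" for v using seminorm_on_nonneg[OF p(1) less(2) that] .
      have Nn: "0 \<le> N v" if "v \<in> U" for v using seminorm_on_nonneg[OF N(1) U(1) that] .
      \<comment> \<open>The off-diagonal term \<open>g (X *v (v - g v))\<close> vanishes for
        \<open>v\<close> in \<open>U\<close>, the kernel of \<open>p\<close>, so its
        \<open>N\<close>-value is dominated by \<open>p v\<close>.\<close>
      have off: "\<exists>C>0. \<forall>v\<in>W. N (g (X *v v)) \<le> N (X *v g v) + C * p v" if X: "X \<in> products A" for X
      proof -
        have lin: "linear (\<lambda>v. g (X *v (v - g v)))"
          using linear_compose[OF linear_compose[OF linear_compose_sub[OF linear_ident g(1)]
              matrix_vector_mul_linear[of X]] g(1)]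
          by (simp add: o_def)
        have q: "seminorm_on W (\<lambda>v. N (g (X *v (v - g v))))"
          by (rule seminorm_on_linear[OF N(1) lin]) (rule g(2))
        have "N (g (X *v (v - g v))) = 0" if "v \<in> W" "p v = 0" for v
          using p(2) that g(3) seminorm_on_zero[OF N(1)] U(1) linear_0[OF g(1)] by (simp add: subspace_0)
        then obtain C where C: "0 < C" "\<And>v. v \<in> W \<Longrightarrow> N (g (X *v (v - g v))) \<le> C * p v"
          using seminorm_on_dominated[OF less(2) p(1) q] by blast
        have "N (g (X *v v)) \<le> N (X *v g v) + C * p v" if v: "v \<in> W" for v
        proof -
          have XU: "X *v g v \<in> U" by (rule products_mult_vector_in[OF U(3) X g(2)])
          have "X *v v = X *v g v + X *v (v - g v)" by (simp add: matrix_vector_mult_diff_distrib)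
          then have "g (X *v v) = X *v g v + g (X *v (v - g v))"
            using g(3)[OF XU] by (metis linear_add[OF g(1)])
          then show ?thesis using seminorm_on_add[OF N(1) XU g(2)[of "X *v (v - g v)"]] C(2)[OF v] by simp
        qed
        then show ?thesis using C(1) by blast
      qed
      obtain CA where CA: "\<And>i. 0 < CA i"
          "\<And>i v. v \<in> W \<Longrightarrow> N (g (A i *v v)) \<le> N (A i *v g v) + CA i * p v"
        using off[OF generator_in_products] by metis
      obtain CB where CB: "0 < CB" "\<And>v. v \<in> W \<Longrightarrow> N (g (?B *v v)) \<le> N (?B *v g v) + CB * p v"
        using off[OF B] by metis
      define C where "C = CB + (\<Sum>i\<in>UNIV. CA i)"
      have C: "0 < C" "CB \<le> C" "CA i \<le> C" for i
        using CA(1) CB(1) member_le_sum[of i UNIV CA] sum_nonneg[of UNIV CA]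
        by (simp_all add: C_def less_imp_le add_pos_nonneg)
      \<comment> \<open>The part \<open>C / \<epsilon>\<close> lets
        \<open>\<epsilon> * K * p v\<close> absorb the off-diagonal term of each letter. The part
        \<open>4 * C\<close> bounds that of \<open>?B\<close> by \<open>K / 4 * p v\<close>, which
        together with the contraction \<open>1 / 2\<close> gives \<open>3 / 4\<close>.\<close>
      define K where "K = C / \<epsilon> + 4 * C"
      have K: "0 < K" "C \<le> \<epsilon> * K" "4 * C \<le> K" using C(1) \<epsilon> by (auto simp: K_def field_simps add_pos_pos)
      define N' where "N' v = N (g v) + K * p v" for v
      have "seminorm_on W N'"
        unfolding N'_def using K(1) g(2)
        by (intro seminorm_on_combine seminorm_on_linear[OF N(1) g(1)] p(1)) auto
      moreover have "v = 0" if v: "v \<in> W" "N' v = 0" for v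
      proof -
        have "N (g v) = 0" "K * p v = 0"
          using v Nn[OF g(2)] pn[OF v(1)] K(1) by (auto simp: N'_def add_nonneg_eq_0_iff)
        then show ?thesis using K(1) p(2)[OF v(1)] g(3)[of v] N(2)[of v] by auto
      qed
      moreover have "N' (A i *v v) \<le> (1 + \<epsilon>) * N' v" if v: "v \<in> W" for i v
      proof -
        have "N' (A i *v v) \<le> ((1 + \<epsilon>) * N (g v) + CA i * p v) + K * p v"
          using CA(2)[OF v, of i] N(3)[OF g(2), of i v] p(3)[OF v, of i] K(1) by (simp add: N'_def add_mono)
        also have "\<dots> \<le> (1 + \<epsilon>) * N (g v) + C * p v + K * p v"
          using C(3) pn[OF v] by (simp add: mult_right_mono)
        also have "\<dots> \<le> (1 + \<epsilon>) * N (g v) + (\<epsilon> * K) * p v + K * p v"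
          using K(2) pn[OF v] by (simp add: mult_right_mono)
        also have "\<dots> = (1 + \<epsilon>) * N' v" by (simp add: N'_def algebra_simps)
        finally show ?thesis .
      qed
      moreover have "N' (?B *v v) \<le> 3 / 4 * N' v" if v: "v \<in> W" for v
      proof -
        have "K * p (?B *v v) \<le> K * (1 / 2 * p v)" using BW[OF v] K(1) by (intro mult_left_mono) auto
        then have "N' (?B *v v) \<le> (3 / 4 * N (g v) + CB * p v) + K * (1 / 2 * p v)"
          using CB(2)[OF v] N(4)[OF g(2), of v] unfolding N'_def by linarith
        also have "CB * p v \<le> K / 4 * p v"
          using C(2) K(3) pn[OF v] by (intro mult_right_mono) auto
        then have "(3 / 4 * N (g v) + CB * p v) + K * (1 / 2 * p v) \<le>
            3 / 4 * N (g v) + (K / 4) * p v + K * (1 / 2 * p v)" by simp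
        also have "\<dots> = 3 / 4 * N' v" by (simp add: N'_def algebra_simps)
        finally show ?thesis .
      qed
      ultimately show "\<exists>N. seminorm_on W N \<and> (\<forall>v\<in>W. N v = 0 \<longrightarrow> v = 0) \<and>
        (\<forall>i. \<forall>v\<in>W. N (A i *v v) \<le> (1 + \<epsilon>) * N v) \<and> (\<forall>v\<in>W. N (?B *v v) \<le> 3 / 4 * N v)"
        by blast
    qed
  qed
qed

end

subsection \<open>Markov measures\<close>

text \<open>A partial sum \<open>s\<close> satisfies \<open>s \<le> b + \<kappa> * s\<close>, where
  \<open>b\<close> is the sum of the first \<open>m\<close> terms; solving for \<open>s\<close>
  gives a uniform bound.\<close>

lemma summable_if_eventually_contracting:
  fixes f :: "nat \<Rightarrow> real"
  assumes nonneg: "\<And>n. 0 \<le> f n" and step: "\<And>n. f (n + m) \<le> \<kappa> * f n" and "\<kappa> < 1"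
  shows "summable f"
proof (rule summableI_nonneg_bounded[OF nonneg])
  fix n
  have "sum f {..<n} \<le> sum f {..<n + m}" by (intro sum_mono2) (auto intro: nonneg)
  also have "\<dots> = sum f {..<m} + (\<Sum>i<n. f (i + m))"
    by (induction n) (simp_all add: add_ac)
  also have "\<dots> \<le> sum f {..<m} + \<kappa> * sum f {..<n}"
    by (simp add: sum_distrib_left sum_mono step)
  finally show "sum f {..<n} \<le> sum f {..<m} / (1 - \<kappa>)" using \<open>\<kappa> < 1\<close> by (simp add: field_simps)
qed

text \<open>The conditional expectation of \<open>N\<close> after \<open>k\<close> further steps,
  given the current symbol \<open>i\<close> and the current vector \<open>v\<close>.\<close>

primrec markov_iterate ::
    "real ^ 'l ^ 'l \<Rightarrow> ('l::finite \<Rightarrow> complex ^ 'd ^ 'd) \<Rightarrow> (complex ^ 'd \<Rightarrow> real) \<Rightarrow> nat \<Rightarrow>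
      'l \<Rightarrow> complex ^ 'd \<Rightarrow> real" where
  "markov_iterate P A N 0 i v = N v"
| "markov_iterate P A N (Suc k) i v = (\<Sum>j\<in>UNIV. P $ i $ j * markov_iterate P A N k j (A j *v v))"

lemma power_letter_bound:
  fixes N :: "complex ^ 'd \<Rightarrow> real"
  assumes "\<And>v. 0 \<le> N v" "\<And>i v. N (A i *v v) \<le> c * N v" "1 \<le> c"
  shows "N (mpow (A a) k *v v) \<le> c ^ k * N v"
proof (induction k arbitrary: v)
  case (Suc k)
  have "N (mpow (A a) (Suc k) *v v) \<le> c ^ k * N (A a *v v)"
    using Suc by (simp add: mpow_commute matrix_vector_mul_assoc [symmetric])
  also have "\<dots> \<le> c ^ k * (c * N v)" using assms(3) by (intro mult_left_mono[OF assms(2)]) auto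
  finally show ?case by (simp add: mult_ac)
qed simp

text \<open>The constant word \<open>a \<dots> a\<close> has weight at least \<open>r ^ k\<close>. All other words are estimated
  by \<open>c ^ k\<close>.\<close>

lemma markov_iterate_le:
  fixes N :: "complex ^ 'd \<Rightarrow> real"
  assumes P: "stochastic_matrix P" "\<And>i j. r \<le> P $ i $ j" "0 < r" "r \<le> 1"
    and N: "\<And>v. 0 \<le> N v" "\<And>i v. N (A i *v v) \<le> c * N v" "1 \<le> c"
  shows "markov_iterate P A N k i v \<le> c ^ k * N v - r ^ k * (c ^ k * N v - N (mpow (A a) k *v v))"
proof (induction k arbitrary: i v)
  case (Suc k)
  let ?G = "markov_iterate P A N k"
  let ?n = "N (mpow (A a) (Suc k) *v v)"
  have Pn: "0 \<le> P $ i $ j" for j using P(1) by (simp add: stochastic_matrix_def)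
  have n: "mpow (A a) k *v (A a *v v) = mpow (A a) (Suc k) *v v"
    by (simp add: mpow_commute matrix_vector_mul_assoc [symmetric])
  have ck: "c ^ k * N (A j *v v) \<le> c ^ Suc k * N v" for j
    using mult_left_mono[OF N(2)[of j v], of "c ^ k"] N(3) by (simp add: mult_ac)
  have rk: "0 \<le> r ^ k" "r ^ k \<le> 1" using P(3,4) by (auto intro: power_le_one)
  have G: "?G j (A j *v v) \<le> c ^ Suc k * N v" for j
  proof -
    have "0 \<le> r ^ k * (c ^ k * N (A j *v v) - N (mpow (A a) k *v (A j *v v)))"
      using power_letter_bound[where N = N and A = A and c = c and a = a and k = k and v = "A j *v v"] N rk
      by (intro mult_nonneg_nonneg) auto
    then show ?thesis using Suc[of j "A j *v v"] ck[of j] by linarith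
  qed
  have Ga: "?G a (A a *v v) \<le> c ^ Suc k * N v - r ^ k * (c ^ Suc k * N v - ?n)"
  proof -
    \<comment> \<open>The bound from the induction hypothesis increases with
      \<open>c ^ k * N (A a *v v)\<close>, whose coefficient is \<open>1 - r ^ k\<close>.\<close>
    have "(1 - r ^ k) * (c ^ k * N (A a *v v)) \<le> (1 - r ^ k) * (c ^ Suc k * N v)"
      using ck rk by (intro mult_left_mono) auto
    then show ?thesis using Suc[of a "A a *v v"] unfolding n by (simp add: algebra_simps)
  qed
  have "markov_iterate P A N (Suc k) i v =
      P $ i $ a * ?G a (A a *v v) + (\<Sum>j\<in>UNIV - {a}. P $ i $ j * ?G j (A j *v v))"
    by (simp add: sum.remove[of UNIV a])
  also have "\<dots> \<le> P $ i $ a * (c ^ Suc k * N v - r ^ k * (c ^ Suc k * N v - ?n)) +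
      (\<Sum>j\<in>UNIV - {a}. P $ i $ j * (c ^ Suc k * N v))"
    using Pn G Ga by (intro add_mono mult_left_mono sum_mono) auto
  also have "(\<Sum>j\<in>UNIV - {a}. P $ i $ j * (c ^ Suc k * N v)) = (\<Sum>j\<in>UNIV - {a}. P $ i $ j) * (c ^ Suc k * N v)"
    by (simp only: sum_distrib_right)
  also have "P $ i $ a * (c ^ Suc k * N v - r ^ k * (c ^ Suc k * N v - ?n)) + \<dots> =
      (\<Sum>j\<in>UNIV. P $ i $ j) * (c ^ Suc k * N v) - P $ i $ a * (r ^ k * (c ^ Suc k * N v - ?n))"
    by (simp add: sum.remove[of UNIV a] algebra_simps)
  also have "\<dots> = c ^ Suc k * N v - P $ i $ a * (r ^ k * (c ^ Suc k * N v - ?n))"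
    using P(1) by (simp add: stochastic_matrix_def)
  \<comment> \<open>Replacing \<open>P $ i $ a\<close> by \<open>r\<close> is allowed because the
    subtracted gain is nonnegative by \<open>power_letter_bound\<close>.\<close>
  also have "\<dots> \<le> c ^ Suc k * N v - r * (r ^ k * (c ^ Suc k * N v - ?n))"
    using power_letter_bound[where N = N and A = A and c = c and a = a and k = "Suc k" and v = v] N rk P(2)
    by (intro diff_mono mult_right_mono mult_nonneg_nonneg) auto
  finally show ?case by (simp add: mult_ac)
qed simp

text \<open>At \<open>\<epsilon> = 0\<close> the expression equals \<open>1 - \<delta> / 4\<close>;
  continuity does the rest.\<close>

lemma contraction_rate_exists:
  fixes \<delta> :: real
  assumes "0 < \<delta>"
  obtains \<epsilon> :: real where "0 < \<epsilon>" "(1 + \<epsilon>) ^ m - \<delta> * ((1 + \<epsilon>) ^ m - 3 / 4) < 1"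
proof -
  have "((\<lambda>e. (1 + e) ^ m - \<delta> * ((1 + e) ^ m - 3 / 4)) \<longlongrightarrow> (1 + 0) ^ m - \<delta> * ((1 + 0) ^ m - 3 / 4)) (at_right 0)"
    by (intro tendsto_intros)
  moreover have "(1 + 0) ^ m - \<delta> * ((1 + 0) ^ m - 3 / 4) < 1" using assms by simp
  ultimately have "\<forall>\<^sub>F e in at_right 0. (1 + e) ^ m - \<delta> * ((1 + e) ^ m - 3 / 4) < 1"
    by (rule order_tendstoD(2))
  moreover have "\<forall>\<^sub>F e :: real in at_right 0. 0 < e" by (rule eventually_at_right_less)
  ultimately have "\<forall>\<^sub>F e in at_right 0. 0 < e \<and> (1 + e) ^ m - \<delta> * ((1 + e) ^ m - 3 / 4) < 1"
    by eventually_elim simp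
  then show thesis using that eventually_happens trivial_limit_at_right_real by blast
qed

definition depends_upto :: "nat \<Rightarrow> ((nat \<Rightarrow> 'l) \<Rightarrow> real) \<Rightarrow> bool" where
  "depends_upto n h \<longleftrightarrow> (\<forall>x y. (\<forall>k\<le>n. x k = y k) \<longrightarrow> h x = h y)"

section \<open>Expectations of functions of finitely many symbols\<close>

context
  fixes P :: "real ^ 'l ^ 'l" and q :: "real ^ 'l" and \<mu> :: "(nat \<Rightarrow> 'l::finite) measure"
  assumes markov: "markov_measure P q \<mu>"
begin

lemma prob_space_markov: "prob_space \<mu>"
  and sets_markov: "sets \<mu> = sets shift_algebra"
  and measure_cylinder:
    "measure \<mu> {x. \<forall>k\<le>n. x k = w k} = q $ w 0 * (\<Prod>k<n. P $ w k $ w (Suc k))"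
  using markov by (auto simp: markov_measure_def)

lemma space_markov: "space \<mu> = UNIV"
  using sets_eq_imp_space_eq[OF sets_markov] by (simp add: shift_algebra_def space_PiM)

lemma cylinder_in_sets: "{x. \<forall>k\<le>n. x k = w k} \<in> sets \<mu>"
proof -
  have coord: "(\<lambda>x. x k) \<in> measurable \<mu> (count_space UNIV)" for k
  proof -
    have "(\<lambda>x. x k) \<in> measurable shift_algebra (count_space UNIV)"
      unfolding shift_algebra_def by (rule measurable_component_singleton) simp
    then show ?thesis using measurable_cong_sets[OF sets_markov refl] by blast
  qed
  have "{x. \<forall>k\<le>n. x k = w k} = (\<Inter>k\<in>{..n}. (\<lambda>x. x k) -` {w k} \<inter> space \<mu>)"
    by (auto simp: space_markov)
  also have "\<dots> \<in> sets \<mu>" by (intro sets.finite_INT measurable_sets[OF coord]) auto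
  finally show ?thesis .
qed

definition cylinder_weight :: "nat \<Rightarrow> (nat \<Rightarrow> 'l) \<Rightarrow> real" where
  "cylinder_weight n w = q $ w 0 * (\<Prod>k<n. P $ w k $ w (Suc k))"

text \<open>The cylinders fixing \<open>n + 1\<close> symbols partition the space. Words are taken
  to be \<open>undefined\<close> beyond \<open>n\<close>, which leaves finitely many of
  them.\<close>

lemma cylinder_sum:
  fixes h :: "(nat \<Rightarrow> 'l) \<Rightarrow> real"
  assumes "depends_upto n h"
  shows "h x = (\<Sum>w\<in>{..n} \<rightarrow>\<^sub>E UNIV. h w * indicator {x. \<forall>k\<le>n. x k = w k} x)"
proof -
  let ?r = "restrict x {..n}"
  have "(\<Sum>w\<in>{..n} \<rightarrow>\<^sub>E UNIV. h w * indicator {x. \<forall>k\<le>n. x k = w k} x) =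
      (\<Sum>w\<in>{..n} \<rightarrow>\<^sub>E UNIV. if w = ?r then h ?r else 0)"
  proof (intro sum.cong refl)
    fix w :: "nat \<Rightarrow> 'l" assume w: "w \<in> {..n} \<rightarrow>\<^sub>E UNIV"
    have "w = ?r \<longleftrightarrow> (\<forall>k\<le>n. x k = w k)"
      using w by (auto simp: PiE_def extensional_def fun_eq_iff restrict_def)
    then show "h w * indicator {x. \<forall>k\<le>n. x k = w k} x = (if w = ?r then h ?r else 0)"
      by (auto simp: indicator_def)
  qed
  also have "\<dots> = h ?r" by (simp add: finite_PiE)
  also have "\<dots> = h x" using assms by (auto simp: depends_upto_def)
  finally show ?thesis by simp
qed

lemma has_bochner_integral_depends_upto:
  assumes "depends_upto n h"
  shows "has_bochner_integral \<mu> h (\<Sum>w\<in>{..n} \<rightarrow>\<^sub>E UNIV. cylinder_weight n w * h w)"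
proof -
  interpret prob_space \<mu> by (rule prob_space_markov)
  have "has_bochner_integral \<mu> (\<lambda>x. \<Sum>w\<in>{..n} \<rightarrow>\<^sub>E UNIV. h w * indicator {x. \<forall>k\<le>n. x k = w k} x)
      (\<Sum>w\<in>{..n} \<rightarrow>\<^sub>E UNIV. h w * measure \<mu> {x. \<forall>k\<le>n. x k = w k})"
    by (intro has_bochner_integral_sum has_bochner_integral_mult_right
        has_bochner_integral_real_indicator cylinder_in_sets) (simp add: less_top [symmetric])
  moreover have "(\<lambda>x. \<Sum>w\<in>{..n} \<rightarrow>\<^sub>E UNIV. h w * indicator {x. \<forall>k\<le>n. x k = w k} x) = h"
    by (rule ext, rule cylinder_sum[OF assms, symmetric])
  ultimately show ?thesis
    by (simp add: measure_cylinder cylinder_weight_def mult.commute)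
qed

text \<open>The Markov property in integrated form: appending \<open>j\<close> to a word multiplies
  its weight by the transition probability from its last symbol.\<close>

lemma integral_markov_step:
  assumes "depends_upto (Suc n) h"
  shows "(\<integral>x. h x \<partial>\<mu>) = (\<integral>x. (\<Sum>j\<in>UNIV. P $ x n $ j * h (x(Suc n := j))) \<partial>\<mu>)"
proof -
  have dep: "depends_upto n (\<lambda>x. \<Sum>j\<in>UNIV. P $ x n $ j * h (x(Suc n := j)))"
    unfolding depends_upto_def
  proof (intro allI impI sum.cong refl)
    fix x y :: "nat \<Rightarrow> 'l" and j assume eq: "\<forall>k\<le>n. x k = y k"
    then have "h (x(Suc n := j)) = h (y(Suc n := j))"
      by (intro assms[unfolded depends_upto_def, rule_format]) (auto simp: le_Suc_eq)
    then show "P $ x n $ j * h (x(Suc n := j)) = P $ y n $ j * h (y(Suc n := j))" using eq by simp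
  qed
  have "(\<integral>x. h x \<partial>\<mu>) = (\<Sum>w\<in>{..Suc n} \<rightarrow>\<^sub>E UNIV. cylinder_weight (Suc n) w * h w)"
    using has_bochner_integral_depends_upto[OF assms] by (rule has_bochner_integral_integral_eq)
  also have "{..Suc n} \<rightarrow>\<^sub>E (UNIV :: 'l set) = (\<lambda>(j, w). w(Suc n := j)) ` (UNIV \<times> ({..n} \<rightarrow>\<^sub>E UNIV))"
    unfolding atMost_Suc by (rule PiE_insert_eq)
  also have "(\<Sum>w\<in>\<dots>. cylinder_weight (Suc n) w * h w) =
      (\<Sum>(j, w)\<in>UNIV \<times> ({..n} \<rightarrow>\<^sub>E UNIV). cylinder_weight (Suc n) (w(Suc n := j)) * h (w(Suc n := j)))"
    by (subst sum.reindex) (auto intro!: inj_combinator sum.cong)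
  also have "\<dots> = (\<Sum>w\<in>{..n} \<rightarrow>\<^sub>E UNIV. \<Sum>j\<in>UNIV. cylinder_weight (Suc n) (w(Suc n := j)) * h (w(Suc n := j)))"
    by (subst sum.cartesian_product [symmetric]) (rule sum.swap)
  also have "\<dots> = (\<Sum>w\<in>{..n} \<rightarrow>\<^sub>E UNIV. cylinder_weight n w * (\<Sum>j\<in>UNIV. P $ w n $ j * h (w(Suc n := j))))"
  proof (intro sum.cong refl)
    fix w :: "nat \<Rightarrow> 'l"
    have "cylinder_weight (Suc n) (w(Suc n := j)) = cylinder_weight n w * P $ w n $ j" for j
    proof -
      have "(\<Prod>k<n. P $ (w(Suc n := j)) k $ (w(Suc n := j)) (Suc k)) = (\<Prod>k<n. P $ w k $ w (Suc k))"
        by (intro prod.cong) auto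
      then show ?thesis by (simp add: cylinder_weight_def)
    qed
    then show "(\<Sum>j\<in>UNIV. cylinder_weight (Suc n) (w(Suc n := j)) * h (w(Suc n := j))) =
        cylinder_weight n w * (\<Sum>j\<in>UNIV. P $ w n $ j * h (w(Suc n := j)))"
      by (simp add: sum_distrib_left mult.assoc)
  qed
  also have "\<dots> = (\<integral>x. (\<Sum>j\<in>UNIV. P $ x n $ j * h (x(Suc n := j))) \<partial>\<mu>)"
    using has_bochner_integral_depends_upto[OF dep] by (rule has_bochner_integral_integral_eq[symmetric])
  finally show ?thesis .
qed

lemma depends_upto_cocycle:
  fixes A :: "'l \<Rightarrow> complex ^ 'd ^ 'd"
  shows
  "depends_upto n (\<lambda>x. F (x n) (cocycle A x (Suc n) *v v))"
  unfolding depends_upto_def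
proof (intro allI impI)
  fix x y :: "nat \<Rightarrow> 'l" assume eq: "\<forall>k\<le>n. x k = y k"
  then have "cocycle A x (Suc n) = cocycle A y (Suc n)" by (intro cocycle_cong) auto
  then show "F (x n) (cocycle A x (Suc n) *v v) = F (y n) (cocycle A y (Suc n) *v v)" using eq by simp
qed

text \<open>A tower property: one Markov step trades an iteration of \<open>markov_iterate\<close>
  for one more symbol of the sequence. \<open>cocycle A x (Suc n)\<close> ends with the letter
  \<open>x n\<close>, from which the next transition starts.\<close>

lemma integral_markov_iterate:
  fixes A :: "'l \<Rightarrow> complex ^ 'd ^ 'd"
  shows
  "(\<integral>x. markov_iterate P A N k (x n) (cocycle A x (Suc n) *v v) \<partial>\<mu>) =
    (\<integral>x. N (cocycle A x (Suc (n + k)) *v v) \<partial>\<mu>)"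
proof (induction k arbitrary: n)
  case (Suc k)
  define h where "h x = markov_iterate P A N k (x (Suc n)) (cocycle A x (Suc (Suc n)) *v v)" for x
  have "h (x(Suc n := j)) = markov_iterate P A N k j (A j *v (cocycle A x (Suc n) *v v))" for x j
  proof -
    have "cocycle A (x(Suc n := j)) (Suc n) = cocycle A x (Suc n)" by (intro cocycle_cong) auto
    then have "cocycle A (x(Suc n := j)) (Suc (Suc n)) = A j ** cocycle A x (Suc n)"
      by (simp del: cocycle.simps(2) add: cocycle.simps(2)[of A _ "Suc n"])
    then show ?thesis by (simp add: h_def matrix_vector_mul_assoc)
  qed
  then have "(\<integral>x. markov_iterate P A N (Suc k) (x n) (cocycle A x (Suc n) *v v) \<partial>\<mu>) = (\<integral>x. h x \<partial>\<mu>)"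
    using integral_markov_step[of n h] depends_upto_cocycle[of "Suc n" "markov_iterate P A N k" A v]
    unfolding h_def by simp
  then show ?case using Suc[of "Suc n"] by (simp add: h_def)
qed simp

text \<open>The expectations shrink by \<open>\<kappa>\<close> every \<open>m\<close> steps, so they
  are summable. The series of the values then has finite expectation and converges almost surely,
  which sends its terms to zero.\<close>

lemma AE_tendsto_zero_if_contracting:
  fixes A :: "'l \<Rightarrow> complex ^ 'd ^ 'd"
  assumes N: "\<And>v. 0 \<le> N v" and \<kappa>: "\<kappa> < 1" "\<And>i v. markov_iterate P A N m i v \<le> \<kappa> * N v"
  shows "AE x in \<mu>. (\<lambda>n. N (cocycle A x (Suc n) *v v)) \<longlonglongrightarrow> 0"
proof -
  define f where "f n x = N (cocycle A x (Suc n) *v v)" for n x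
  define E where "E n = (\<integral>x. f n x \<partial>\<mu>)" for n
  have int: "integrable \<mu> (\<lambda>x. F (x n) (cocycle A x (Suc n) *v v))"
    for F :: "'l \<Rightarrow> complex ^ 'd \<Rightarrow> real" and n
    by (rule integrable.intros[OF has_bochner_integral_depends_upto[OF depends_upto_cocycle[of n F A v]]])
  have intf: "integrable \<mu> (f n)" for n
    unfolding f_def using int[of "\<lambda>_. N"] by simp
  have fn: "0 \<le> f n x" for n x by (simp add: f_def N del: cocycle.simps)
  have "E (n + m) \<le> \<kappa> * E n" for n
  proof -
    have "E (n + m) = (\<integral>x. markov_iterate P A N m (x n) (cocycle A x (Suc n) *v v) \<partial>\<mu>)"
      unfolding E_def f_def by (rule integral_markov_iterate[symmetric])
    also have "\<dots> \<le> (\<integral>x. \<kappa> * f n x \<partial>\<mu>)"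
      using \<kappa>(2) by (intro integral_mono int integrable_mult_right intf) (simp add: f_def del: cocycle.simps)
    finally show ?thesis by (simp add: E_def)
  qed
  then have sE: "summable E"
    using \<kappa>(1) by (intro summable_if_eventually_contracting[of E m \<kappa>]) (auto simp: E_def fn)
  have "(\<integral>\<^sup>+x. (\<Sum>n. ennreal (f n x)) \<partial>\<mu>) = (\<Sum>n. \<integral>\<^sup>+x. ennreal (f n x) \<partial>\<mu>)"
    using intf by (intro nn_integral_suminf) auto
  also have "\<dots> = (\<Sum>n. ennreal (E n))"
    using intf fn by (simp add: nn_integral_eq_integral E_def)
  also have "\<dots> = ennreal (suminf E)"
    using fn by (intro suminf_ennreal2 sE) (simp add: E_def)
  finally have "(\<integral>\<^sup>+x. (\<Sum>n. ennreal (f n x)) \<partial>\<mu>) \<noteq> \<infinity>" by simp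
  then have "AE x in \<mu>. (\<Sum>n. ennreal (f n x)) \<noteq> \<infinity>"
    using intf by (intro nn_integral_PInf_AE) auto
  then show ?thesis
  proof eventually_elim
    case (elim x)
    then have "summable (\<lambda>n. f n x)" using fn by (intro summable_suminf_not_top) auto
    then show ?case unfolding f_def by (rule summable_LIMSEQ_zero)
  qed
qed

end

theorem theorem5p1:
  fixes A :: "'l::finite \<Rightarrow> complex ^ 'd ^ 'd"
  assumes "periodically_asymptotically_stable A"
  shows "markov_asymptotically_stable A"
  unfolding markov_asymptotically_stable_def
proof (intro allI impI)
  fix P :: "real ^ 'l ^ 'l" and q and \<mu> :: "(nat \<Rightarrow> 'l) measure"
  assume "markov_measure P q \<mu> \<and> (\<forall>i j. 0 < P $ i $ j)"
  then have markov: "markov_measure P q \<mu>" and pos: "\<And>i j. 0 < P $ i $ j" by auto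
  have P: "stochastic_matrix P" using markov by (simp add: markov_measure_def)
  \<comment> \<open>Any letter serves as the one that is repeated.\<close>
  define a :: 'l where "a = undefined"
  obtain m where m: "\<And>\<epsilon>. \<epsilon> > 0 \<Longrightarrow> \<exists>N. seminorm_on UNIV N \<and> (\<forall>v. N v = 0 \<longrightarrow> v = 0) \<and>
      (\<forall>i v. N (A i *v v) \<le> (1 + \<epsilon>) * N v) \<and> (\<forall>v. N (mpow (A a) m *v v) \<le> 3 / 4 * N v)"
    using adapted_norm_on_subspace[OF assms subspace_UNIV, of a] by auto
  \<comment> \<open>A common positive lower bound of the transition probabilities, capped to meet
    the condition \<open>r \<le> 1\<close> of \<open>markov_iterate_le\<close>.\<close>
  define r where "r = min 1 (Min (range (\<lambda>(i, j). P $ i $ j)))"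
  have r: "0 < r" "r \<le> 1" "\<And>i j. r \<le> P $ i $ j"
  proof -
    have "Min (range (\<lambda>(i, j). P $ i $ j)) \<le> P $ i $ j" for i j
      by (intro Min_le) (auto intro: image_eqI[of _ _ "(i, j)"])
    then show "r \<le> P $ i $ j" for i j by (simp add: r_def min.coboundedI2)
  qed (use pos in \<open>auto simp: r_def Min_gr_iff\<close>)
  \<comment> \<open>The order of choices matters: \<open>m\<close> and \<open>r ^ m\<close> are
    fixed before \<open>\<epsilon>\<close>, and the norm \<open>N\<close> depends on
    \<open>\<epsilon>\<close>.\<close>
  obtain \<epsilon> where \<epsilon>: "0 < \<epsilon>" "(1 + \<epsilon>) ^ m - r ^ m * ((1 + \<epsilon>) ^ m - 3 / 4) < 1"
    using contraction_rate_exists[of "r ^ m" m] r(1) by auto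
  let ?\<kappa> = "(1 + \<epsilon>) ^ m - r ^ m * ((1 + \<epsilon>) ^ m - 3 / 4)"
  obtain N where N: "seminorm_on UNIV N" "\<And>v. N v = 0 \<Longrightarrow> v = 0"
      "\<And>i v. N (A i *v v) \<le> (1 + \<epsilon>) * N v" "\<And>v. N (mpow (A a) m *v v) \<le> 3 / 4 * N v"
    using m[OF \<epsilon>(1)] by blast
  have Nn: "0 \<le> N v" for v using seminorm_on_nonneg[OF N(1)] by simp
  have \<kappa>: "markov_iterate P A N m i v \<le> ?\<kappa> * N v" for i v
  proof -
    have "markov_iterate P A N m i v \<le>
        (1 + \<epsilon>) ^ m * N v - r ^ m * ((1 + \<epsilon>) ^ m * N v - N (mpow (A a) m *v v))"
      using \<epsilon>(1) by (intro markov_iterate_le P r Nn N(3)) auto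
    also have "\<dots> \<le> (1 + \<epsilon>) ^ m * N v - r ^ m * ((1 + \<epsilon>) ^ m * N v - 3 / 4 * N v)"
      using N(4)[of v] r(1) by (intro diff_left_mono mult_left_mono[of _ _ "r ^ m"]) auto
    finally show ?thesis by (simp add: algebra_simps)
  qed
  \<comment> \<open>As \<open>N\<close> vanishes only at zero, it dominates the standard norm, so
    decay of \<open>N\<close> is genuine convergence.\<close>
  obtain C where C: "0 < C" "\<And>v. norm v \<le> C * N v"
    using seminorm_on_dominated[OF subspace_UNIV N(1) seminorm_on_norm_linear[OF linear_ident]] N(2)
    by auto
  have "AE x in \<mu>. (\<lambda>n. cocycle A x n *v v) \<longlonglongrightarrow> 0" for v
    using AE_tendsto_zero_if_contracting[OF markov Nn \<epsilon>(2) \<kappa>, of v]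
  proof eventually_elim
    case (elim x)
    have "(\<lambda>n. C * N (cocycle A x (Suc n) *v v)) \<longlonglongrightarrow> 0"
      using tendsto_mult_right_zero[OF elim, of C] by simp
    then have "(\<lambda>n. cocycle A x (Suc n) *v v) \<longlonglongrightarrow> 0"
      by (rule Lim_null_comparison[rotated]) (use C(2) in \<open>auto simp del: cocycle.simps\<close>)
    then show ?case by (simp only: filterlim_sequentially_Suc[of "\<lambda>n. cocycle A x n *v v"])
  qed
  \<comment> \<open>The exceptional null set depends on \<open>v\<close>; finitely many basis
    vectors suffice, since they yield the columns of the cocycle.\<close>
  then have "AE x in \<mu>. \<forall>j\<in>UNIV. (\<lambda>n. cocycle A x n *v axis j 1) \<longlonglongrightarrow> 0"
    by (intro AE_finite_allI) auto
  then show "AE x in \<mu>. cocycle A x \<longlonglongrightarrow> 0"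
  proof eventually_elim
    case (elim x)
    have "(\<lambda>n. cocycle A x n $ i $ j) \<longlonglongrightarrow> 0" for i j
    proof -
      have "(\<lambda>n. (cocycle A x n *v axis j 1) $ i) \<longlonglongrightarrow> 0 $ i"
        using elim by (intro tendsto_vec_nth) simp
      then show ?thesis by (simp add: matrix_vector_mult_def axis_def if_distrib cong: if_cong)
    qed
    then show ?case by (intro vec_tendstoI) simp
  qed
qed

end
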